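(* The local monodromy $\rho_{\mathrm{trc}}$ (around $t=27/5$) acting on $\mathrm{Hom}_{\mathbb Z\mathcal I}(V_o,H_1(\Sigma;\mathbb Z))$ fixes $U_{\mathrm{trc}}$ and sends $U_{\mathrm{edge}}$ to $U_{\mathrm{edge}}+U_{\mathrm{trc}}$; the local monodromy $\rho_{\mathrm{edge}}$ (around $t=\infty$) fixes $U_{\mathrm{edge}}$ and sends $U_{\mathrm{trc}}$ to $U_{\mathrm{trc}}-3U_{\mathrm{edge}}$.
   Context: Setup: $D\subset\mathbb R^3$ regular dodecahedron centered at $0$, $\mathcal I\subset\mathrm{SO}(3)$ its rotation group ($\cong A_5$), $\iota=-\mathrm{id}$. $\mathcal K$ = the five inscribed cubes ($\mathcal I$ acts as even permutations), $V_o:=\mathbb Z^{\mathcal K}/\mathbb Z(\sum e)$, $\bar e$ the image of $e$. $\hat\Sigma$: surface $D$ with an $\mathcal I$- and $\iota$-invariant small open equilateral triangle removed at each vertex; $\Sigma$: $\hat\Sigma$ with boundary points $p\sim\iota p$ identified (closed oriented genus-10 surface with edge-type and truncation-type $1$-cells). $\delta_x$ (vertex $x$): counterclockwise boundary of the removed triangle at $x$; $\delta_y$ (oriented edge $y$, initial point $in(y)$): loop formed by edge-type cells $y$ and $\iota y$. $\Delta_{\mathrm{trc}}=\{\delta_x\}$, $\Delta_{\mathrm{edge}}=\{\delta_y\}$. For fixed $e\in\mathcal K$, $E$ is one of the two 4-element sets of pairwise non-adjacent vertices of $e$; $u_{\mathrm{trc}},u_{\mathrm{edge}}:V_o\to Z_1(\Sigma)$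 are the $\mathbb Z\mathcal I$-maps with $u_{\mathrm{trc}}(\bar e)=\sum_{x\in E}\delta_x$, $u_{\mathrm{edge}}(\bar e)=\sum_{x\in E}\sum_{in(y)=x}\delta_y$; $U_{\mathrm{trc}}$ is the class of $u_{\mathrm{trc}}$ and $U_{\mathrm{edge}}$ one third of the class of $u_{\mathrm{edge}}$ in $\mathrm{Hom}_{\mathbb Z\mathcal I}(V_o,H_1(\Sigma;\mathbb Z))$ (these form a $\mathbb Z$-basis). Winger pencil: the pencil of $\mathcal I$-invariant plane sextics, base $\mathcal B\cong\mathbb P^1$ with coordinate $t$, with singular members $C_0$ (triple conic), $C_\infty$ (six lines), $C_{27/5}$ (irreducible, ten nodes), $C_{-1}$ (irreducible, six nodes), other members smooth of genus 10. For $\tau\in(0,1)$, the piecewise Euclidean metric on $\hat\Sigma$ with edge-type edges of length $\tau$ and truncation-type edges of length $1-\tau$ induces an $\mathcal I$-invariant complex structure on $\Sigma$ making it isomorphic (as $\mathcal I$-curve) to $C_{\gamma(\tau)}$ with $\gamma(\tau)$ real in $(27/5,\infty)$; as $\tau\to0$ the family degenerates to $C_\infty$ with vanishing cycles $\Delta_{\mathrm{edge}}$, and as $\tau\to1$ to $C_{27/5}$ with vanishing cycles $\Delta_{\mathrm{trc}}$. Using this to identify $H_1(\Sigma)$ with $H_1(C_t)$ for $t$ on this real interval, $\rho_{\mathrm{edge}}$ and $\rho_{\mathrm{trc}}$ are the monodromies along small loops around $\infty$ resp. $27/5$, given by the Picard–Lefschetz formula $h\mapsto h+\sum_{\delta\in\Delta/\{\pm1\}}\langle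 h,\delta\rangle\delta$ with $\Delta=\Delta_{\mathrm{edge}}$ resp. $\Delta_{\mathrm{trc}}$; they act on $\mathrm{Hom}_{\mathbb Z\mathcal I}(V_o,H_1(\Sigma;\mathbb Z))$ by composition. *)

theory Defs
  imports "HOL-Analysis.Analysis"
begin

text \<open>
Combinatorial model of the genus-10 surface Sigma built from a regular dodecahedron D
(centered at 0), following the setup: at each vertex a small triangle is removed, and
boundary points p, iota p are identified.  All topology that the statement needs
(cycles, boundaries, homology, intersection pairing, Picard-Lefschetz operators)
is given cellularly.
\<close>

definition gold :: real where "gold = (1 + sqrt 5) / 2"

definition dodeca_vertices :: "(real^3) set" where
  "dodeca_vertices =
     {vector [a, b, c] | a b c. a \<in> {-1, 1} \<and> b \<in> {-1, 1} \<and> c \<in> {-1, 1}}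
   \<union> {vector [0, a / gold, b * gold] | a b. a \<in> {-1, 1} \<and> b \<in> {-1, 1}}
   \<union> {vector [a / gold, b * gold, 0] | a b. a \<in> {-1, 1} \<and> b \<in> {-1, 1}}
   \<union> {vector [a * gold, 0, b / gold] | a b. a \<in> {-1, 1} \<and> b \<in> {-1, 1}}"

definition edge_len :: real where
  "edge_len = Min {dist p q | p q. p \<in> dodeca_vertices \<and> q \<in> dodeca_vertices \<and> p \<noteq> q}"

definition adj :: "real^3 \<Rightarrow> real^3 \<Rightarrow> bool" where
  "adj p q \<longleftrightarrow> p \<in> dodeca_vertices \<and> q \<in> dodeca_vertices \<and> p \<noteq> q \<and> dist p q = edge_len"

definition oedges :: "((real^3) \<times> (real^3)) set" where
  "oedges = {(x, y). adj x y}"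

text \<open>z is the counterclockwise successor of y among the neighbours of x,
  viewed from outside (orientation given by the outward normal x)\<close>
definition ccw_next :: "real^3 \<Rightarrow> real^3 \<Rightarrow> real^3 \<Rightarrow> bool" where
  "ccw_next x y z \<longleftrightarrow> adj x y \<and> adj x z \<and> y \<noteq> z \<and> (cross3 (y - x) (z - x)) \<bullet> x > 0"

definition nxt :: "real^3 \<Rightarrow> real^3 \<Rightarrow> real^3" where
  "nxt x y = (THE z. ccw_next x y z)"

definition prv :: "real^3 \<Rightarrow> real^3 \<Rightarrow> real^3" where
  "prv x y = nxt x (nxt x y)"

definition min_dist :: "(real^3) set \<Rightarrow> real" where
  "min_dist S = Min {dist p q | p q. p \<in> S \<and> q \<in> S \<and> p \<noteq> q}"

definition inscribed_cube :: "(real^3) set \<Rightarrow> bool" where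
  "inscribed_cube S \<longleftrightarrow> S \<subseteq> dodeca_vertices \<and> card S = 8 \<and>
     (\<exists>a>0. \<forall>p\<in>S. \<forall>q\<in>S. p \<noteq> q \<longrightarrow> dist p q \<in> {a, sqrt 2 * a, sqrt 3 * a})"

definition cubes :: "(real^3) set set" where
  "cubes = {S. inscribed_cube S}"

definition tetra_of :: "(real^3) set \<Rightarrow> (real^3) set \<Rightarrow> bool" where
  "tetra_of e E \<longleftrightarrow> E \<subseteq> e \<and> card E = 4 \<and>
     (\<forall>p\<in>E. \<forall>q\<in>E. p \<noteq> q \<longrightarrow> dist p q \<noteq> min_dist e)"

text \<open>Oriented 1-cells (darts).  Ed x y (x, y adjacent): edge-type cell from the
  corner c(x,y) (the corner of the removed triangle at x lying on the edge xy) to c(y,x).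
  Tr x y z (y, z distinct neighbours of x): truncation-type cell from c(x,y) to c(x,z).
  The truncation cells Tr x y z and Tr (-x) (-y) (-z) are the same cell of Sigma;
  the 0-cells of Sigma are the classes {c(x,y), c(-x,-y)}.\<close>
datatype dart = Ed "real^3" "real^3" | Tr "real^3" "real^3" "real^3"

definition darts :: "dart set" where
  "darts = {Ed x y | x y. adj x y} \<union> {Tr x y z | x y z. adj x y \<and> adj x z \<and> y \<noteq> z}"

fun drev :: "dart \<Rightarrow> dart" where
  "drev (Ed x y) = Ed y x"
| "drev (Tr x y z) = Tr x z y"

fun diota :: "dart \<Rightarrow> dart" where
  "diota (Ed x y) = Ed x y"
| "diota (Tr x y z) = Tr (- x) (- y) (- z)"

fun is_edge_dart :: "dart \<Rightarrow> bool" where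
  "is_edge_dart (Ed x y) = True"
| "is_edge_dart (Tr x y z) = False"

text \<open>end point (as a corner c(x,y), encoded by the pair (x,y))\<close>
fun dhead :: "dart \<Rightarrow> (real^3) \<times> (real^3)" where
  "dhead (Ed x y) = (y, x)"
| "dhead (Tr x y z) = (x, z)"

definition same_pt :: "(real^3) \<times> (real^3) \<Rightarrow> (real^3) \<times> (real^3) \<Rightarrow> bool" where
  "same_pt p q \<longleftrightarrow> q = p \<or> q = (- fst p, - snd p)"

definition chain1 :: "(dart \<Rightarrow> int) \<Rightarrow> bool" where
  "chain1 f \<longleftrightarrow> (\<forall>d. d \<notin> darts \<longrightarrow> f d = 0) \<and> (\<forall>d. f (drev d) = - f d)
     \<and> (\<forall>d. f (diota d) = f d)"

definition cell :: "dart \<Rightarrow> dart \<Rightarrow> int" where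
  "cell d = (\<lambda>d'. (if d' \<in> {d, diota d} then 1 else 0)
               - (if d' \<in> {drev d, diota (drev d)} then 1 else 0))"

text \<open>coefficient of the boundary at the 0-cell of Sigma containing the corner p
  (each truncation cell is represented by two darts per orientation, hence the weights)\<close>
definition bdry :: "(dart \<Rightarrow> int) \<Rightarrow> (real^3) \<times> (real^3) \<Rightarrow> int" where
  "bdry f p = 2 * (\<Sum>d\<in>{d\<in>darts. is_edge_dart d \<and> same_pt (dhead d) p}. f d)
             + (\<Sum>d\<in>{d\<in>darts. \<not> is_edge_dart d \<and> same_pt (dhead d) p}. f d)"

definition Z1 :: "(dart \<Rightarrow> int) \<Rightarrow> bool" where
  "Z1 f \<longleftrightarrow> chain1 f \<and> (\<forall>p\<in>oedges. bdry f p = 0)"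

text \<open>walking around the face of D to the left of the oriented edge (a,b)\<close>
fun fwalk :: "real^3 \<Rightarrow> real^3 \<Rightarrow> nat \<Rightarrow> (real^3) \<times> (real^3)" where
  "fwalk a b 0 = (a, b)"
| "fwalk a b (Suc k) = (case fwalk a b k of (u, v) \<Rightarrow> (v, nxt v u))"

text \<open>boundary of the (decagonal) 2-cell of Sigma coming from that face\<close>
definition face_chain :: "real^3 \<Rightarrow> real^3 \<Rightarrow> dart \<Rightarrow> int" where
  "face_chain a b = (\<lambda>d. \<Sum>k<5. (case fwalk a b k of (u, v) \<Rightarrow>
                            cell (Ed u v) d + cell (Tr v u (nxt v u)) d))"

definition homologous :: "(dart \<Rightarrow> int) \<Rightarrow> (dart \<Rightarrow> int) \<Rightarrow> bool" where
  "homologous f g \<longleftrightarrow> Z1 f \<and> Z1 g \<and>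
     (\<exists>c :: (real^3) \<times> (real^3) \<Rightarrow> int. \<forall>d. f d - g d = (\<Sum>p\<in>oedges. c p * face_chain (fst p) (snd p) d))"

text \<open>At the 0-cell of Sigma containing c(x,y) the four incident half-edges in
  counterclockwise order\<close>
definition rot :: "real^3 \<Rightarrow> real^3 \<Rightarrow> dart list" where
  "rot x y = [Tr x y (prv x y), Ed x y, Tr x y (nxt x y), Ed (- x) (- y)]"

text \<open>Local intersection formula (average of left and right push-off): at a vertex with
  half-edges h_0..h_{k-1} in ccw order and outgoing flows a_i, b_i, the contribution is
  1/2 * sum_{i<j} (a_i b_j - a_j b_i).  Each 0-cell is counted twice (two corners), hence
  the total is 4 times the intersection number.\<close>
definition int4 :: "(dart \<Rightarrow> int) \<Rightarrow> (dart \<Rightarrow> int) \<Rightarrow> int" where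
  "int4 a b = (\<Sum>p\<in>oedges. let h = rot (fst p) (snd p) in
      \<Sum>i<4. \<Sum>j<4. if i < j then a (h ! i) * b (h ! j) - a (h ! j) * b (h ! i) else 0)"

definition intsec :: "(dart \<Rightarrow> int) \<Rightarrow> (dart \<Rightarrow> int) \<Rightarrow> int" where
  "intsec a b = int4 a b div 4"

definition delta_trc :: "real^3 \<Rightarrow> dart \<Rightarrow> int" where
  "delta_trc x = (\<lambda>d. \<Sum>y\<in>{y. adj x y}. cell (Tr x y (nxt x y)) d)"

definition delta_edge :: "real^3 \<Rightarrow> real^3 \<Rightarrow> dart \<Rightarrow> int" where
  "delta_edge x y = (\<lambda>d. cell (Ed x y) d + cell (Ed (- y) (- x)) d)"

definition Delta_trc :: "(dart \<Rightarrow> int) set" where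
  "Delta_trc = delta_trc ` dodeca_vertices"

definition Delta_edge :: "(dart \<Rightarrow> int) set" where
  "Delta_edge = (\<lambda>p. delta_edge (fst p) (snd p)) ` oedges"

text \<open>Picard-Lefschetz: h + sum over Delta/{+-1} of <h,delta> delta\<close>
definition PL :: "(dart \<Rightarrow> int) set \<Rightarrow> (dart \<Rightarrow> int) \<Rightarrow> dart \<Rightarrow> int" where
  "PL D h = (\<lambda>d. h d + (\<Sum>C\<in>(\<lambda>\<delta>. {\<delta>, (\<lambda>d'. - \<delta> d')}) ` D.
                          (let \<delta> = SOME \<delta>. \<delta> \<in> C in intsec h \<delta> * \<delta> d)))"

definition rho_trc where "rho_trc = PL Delta_trc"
definition rho_edge where "rho_edge = PL Delta_edge"

text \<open>values at (the image of) e of u_trc and u_edge\<close>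
definition u_trc :: "(real^3) set \<Rightarrow> dart \<Rightarrow> int" where
  "u_trc E = (\<lambda>d. \<Sum>x\<in>E. delta_trc x d)"

definition u_edge :: "(real^3) set \<Rightarrow> dart \<Rightarrow> int" where
  "u_edge E = (\<lambda>d. \<Sum>x\<in>E. \<Sum>y\<in>{y. adj x y}. delta_edge x y d)"

end

theory Submission
  imports Defs
begin

text \<open>For a cycle \<open>a\<close> the intersection formula collapses to
  \<open>\<langle>a, \<delta>\<^sub>x\<rangle> = \<Sum>\<^sub>y a (Ed x y)\<close> and
  \<open>\<langle>a, \<delta>\<^bsub>(x,y)\<^esub>\<rangle> = a (Tr x y (prv x y)) + a (Tr y x (nxt y x))\<close>. With
  \<open>\<sigma> = 1\<^sub>E - 1\<^bsub>-E\<^esub>\<close>, the cycle \<open>u_trc E\<close> takes the value \<open>\<sigma> x\<close> on the truncation cells at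
  \<open>x\<close>, and \<open>u_edge E\<close> the value \<open>\<sigma> x - \<sigma> y\<close> on the edge cell from \<open>x\<close> to \<open>y\<close>. Summing the
  Picard-Lefschetz terms over the antipodal pairs gives
  \<open>rho_edge (u_trc E) = u_trc E - u_edge E\<close> on the level of chains. For \<open>rho_trc\<close> one needs that
  \<open>\<sigma>\<close> sums to zero over the neighbours of every vertex. This holds because \<open>E\<close> is a regular
  tetrahedron with centre \<open>0\<close>: pair \<open>\<Sum>E = 0\<close> with a vertex and compare the coefficients of
  \<open>\<surd>5\<close>. The same relation makes the edge differences of \<open>\<sigma>\<close> modulo \<open>3\<close> the differences of a
  potential on the faces of \<open>D\<close>, which shows that \<open>u_edge E\<close> is homologous to a multiple of \<open>3\<close>.\<close>

subsection \<open>Coordinates of the dodecahedron\<close>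

text \<open>\<open>(a, b)\<close> stands for the element \<open>a + b * gold\<close> of the ring generated by the golden ratio.\<close>

type_synonym zgold = "int \<times> int"
type_synonym zpoint = "zgold \<times> zgold \<times> zgold"

text \<open>The term \<open>b * d\<close> enters both components because
  \<open>gold * gold = gold + 1\<close>.\<close>

fun zmul :: "zgold \<Rightarrow> zgold \<Rightarrow> zgold" where
  "zmul (a, b) (c, d) = (a * c + b * d, a * d + b * c + b * d)"

fun zadd :: "zgold \<Rightarrow> zgold \<Rightarrow> zgold" where
  "zadd (a, b) (c, d) = (a + c, b + d)"

fun zsub :: "zgold \<Rightarrow> zgold \<Rightarrow> zgold" where
  "zsub (a, b) (c, d) = (a - c, b - d)"

fun zinner :: "zpoint \<Rightarrow> zpoint \<Rightarrow> zgold" where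
  "zinner (a, b, c) (a', b', c') = zadd (zmul a a') (zadd (zmul b b') (zmul c c'))"

fun zcross :: "zpoint \<Rightarrow> zpoint \<Rightarrow> zpoint" where
  "zcross (a, b, c) (a', b', c') =
     (zsub (zmul b c') (zmul c b'), zsub (zmul c a') (zmul a c'), zsub (zmul a b') (zmul b a'))"

fun rgold :: "zgold \<Rightarrow> real" where
  "rgold (a, b) = of_int a + of_int b * gold"

fun rpoint :: "zpoint \<Rightarrow> real^3" where
  "rpoint (a, b, c) = vector [rgold a, rgold b, rgold c]"

lemma gold_sq: "gold * gold = gold + 1"
  by (simp add: gold_def field_simps)

lemma gold_pos: "gold > 0"
  by (simp add: gold_def add_pos_pos)

lemma inverse_gold: "1 / gold = gold - 1"
  using gold_sq gold_pos by (simp add: field_simps)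

lemma rgold_zmul: "rgold (zmul p q) = rgold p * rgold q"
proof (induction p q rule: zmul.induct)
  case (1 a b c d)
  have "rgold (a, b) * rgold (c, d)
      = of_int a * of_int c + (of_int a * of_int d + of_int b * of_int c) * gold
        + of_int b * of_int d * (gold * gold)"
    by (simp add: algebra_simps)
  then show ?case
    unfolding gold_sq by (simp add: algebra_simps)
qed

lemma rgold_zadd: "rgold (zadd p q) = rgold p + rgold q"
  by (induction p q rule: zadd.induct) (simp add: algebra_simps)

lemma rgold_zsub: "rgold (zsub p q) = rgold p - rgold q"
  by (induction p q rule: zsub.induct) (simp add: algebra_simps)

lemma rgold_zinner: "rgold (zinner p q) = rpoint p \<bullet> rpoint q"
  by (induction p q rule: zinner.induct)
    (simp add: rgold_zmul rgold_zadd inner_vec_def sum_3 del: rgold.simps)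

lemma rpoint_zcross: "rpoint (zcross p q) = cross3 (rpoint p) (rpoint q)"
  by (induction p q rule: zcross.induct)
    (simp add: rgold_zmul rgold_zsub cross3_def del: rgold.simps)

text \<open>The vertices \<open>i\<close> and \<open>19 - i\<close> are antipodal, and the neighbours of a vertex are listed in
  counterclockwise order.\<close>

definition vertex_coords :: "zpoint list" where
  "vertex_coords =
    [((1, 0), (1, 0), (1, 0)), ((1, 0), (1, 0), (-1, 0)),
     ((1, 0), (-1, 0), (1, 0)), ((1, 0), (-1, 0), (-1, 0)),
     ((0, 0), (-1, 1), (0, 1)), ((-1, 1), (0, 1), (0, 0)),
     ((0, 1), (0, 0), (-1, 1)), ((0, 0), (-1, 1), (0, -1)),
     ((-1, 1), (0, -1), (0, 0)), ((0, 1), (0, 0), (1, -1)),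
     ((0, -1), (0, 0), (-1, 1)), ((1, -1), (0, 1), (0, 0)),
     ((0, 0), (1, -1), (0, 1)), ((0, -1), (0, 0), (1, -1)),
     ((1, -1), (0, -1), (0, 0)), ((0, 0), (1, -1), (0, -1)),
     ((-1, 0), (1, 0), (1, 0)), ((-1, 0), (1, 0), (-1, 0)),
     ((-1, 0), (-1, 0), (1, 0)), ((-1, 0), (-1, 0), (-1, 0))]"

definition nbrs :: "nat list list" where
  "nbrs =
    [[4, 6, 5], [5, 9, 7], [6, 12, 8], [8, 15, 9], [0, 16, 12],
     [0, 1, 11], [0, 2, 9], [1, 15, 17], [2, 14, 3], [1, 6, 3],
     [13, 18, 16], [5, 17, 16], [2, 4, 18], [10, 17, 19], [8, 18, 19],
     [3, 19, 7], [4, 11, 10], [7, 13, 11], [10, 14, 12], [13, 15, 14]]"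

definition nx :: "nat \<Rightarrow> nat \<Rightarrow> nat" where
  "nx i j = (let l = nbrs ! i in if j = l ! 0 then l ! 1 else if j = l ! 1 then l ! 2 else l ! 0)"

definition vtx :: "nat \<Rightarrow> real^3" where
  "vtx i = rpoint (vertex_coords ! i)"

lemma dodeca_vertices_eq: "dodeca_vertices = vtx ` {..<20}"
proof -
  have "length vertex_coords = 20"
    by (simp add: vertex_coords_def)
  then have *: "vtx ` {..<20} = rpoint ` set vertex_coords"
    by (force simp: vtx_def set_conv_nth)
  have c: "rgold (-1, 1) = 1 / gold" "rgold (1, -1) = - (1 / gold)"
    "rgold (0, 1) = gold" "rgold (0, -1) = - gold"
    "rgold (0, 0) = 0" "rgold (1, 0) = 1" "rgold (-1, 0) = -1"
    using inverse_gold by simp_all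
  have signs: "{f a b | a b. a \<in> {-1, 1::real} \<and> b \<in> {-1, 1::real}}
      = {f (-1) (-1), f (-1) 1, f 1 (-1), f 1 1}" for f :: "real \<Rightarrow> real \<Rightarrow> real^3"
    by blast
  have signs3: "{f a b c | a b c. a \<in> {-1, 1::real} \<and> b \<in> {-1, 1::real} \<and> c \<in> {-1, 1::real}}
      = {f (-1) (-1) (-1), f (-1) (-1) 1, f (-1) 1 (-1), f (-1) 1 1,
         f 1 (-1) (-1), f 1 (-1) 1, f 1 1 (-1), f 1 1 1}" for f :: "real \<Rightarrow> real \<Rightarrow> real \<Rightarrow> real^3"
    by blast
  show ?thesis
    unfolding * dodeca_vertices_def vertex_coords_def signs signs3
    by (simp add: c insert_commute del: rgold.simps)
qed

text \<open>The values are exact: \<open>(-1, 2)\<close> is \<open>2 * gold - 1\<close>, the square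
  root of 5, and singles out the neighbours, just as 3 and -3 single out the vertex itself and its
  antipode.\<close>

lemma vertex_table:
  "\<forall>i\<in>set [0..<20]. \<forall>j\<in>set [0..<20].
     (let r = zinner (vertex_coords ! i) (vertex_coords ! j) in
       r \<in> set [(1, 0), (-1, 0), (-1, 2), (1, -2), (3, 0), (-3, 0)] \<and>
       (r = (3, 0) \<longleftrightarrow> i = j) \<and> (r = (-3, 0) \<longleftrightarrow> i + j = 19) \<and>
       (r = (-1, 2) \<longleftrightarrow> j \<in> set (nbrs ! i)))"
  by code_simp

text \<open>The triple products 2 and -2 certify that \<open>nbrs\<close> lists the neighbours
  counterclockwise. Since the antipodal map reverses orientation, the successor at
  \<open>19 - i\<close> corresponds to the predecessor at \<open>i\<close>.\<close>

lemma nbrs_table: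
  "\<forall>i\<in>set [0..<20]. length (nbrs ! i) = 3 \<and> (\<forall>j\<in>set (nbrs ! i). j < 20 \<and>
     nx i j \<in> set (nbrs ! i) \<and> nx i j \<noteq> j \<and> nx i (nx i j) \<noteq> j \<and> nx i (nx i j) \<noteq> nx i j \<and>
     set (nbrs ! i) = set [j, nx i j, nx i (nx i j)] \<and> nx i (nx i (nx i j)) = j \<and>
     nx (19 - i) (19 - j) = 19 - nx i (nx i j) \<and>
     zinner (zcross (vertex_coords ! j) (vertex_coords ! nx i j)) (vertex_coords ! i) = (2, 0) \<and>
     zinner (zcross (vertex_coords ! j) (vertex_coords ! nx i (nx i j))) (vertex_coords ! i) = (-2, 0))"
  by code_simp

text \<open>The index form of \<open>face_step\<close>, so that closing up after five steps becomes
  a finite computation.\<close>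

definition walk :: "nat \<times> nat \<Rightarrow> nat \<times> nat" where
  "walk p = (snd p, nx (snd p) (fst p))"

definition oedge_list :: "(nat \<times> nat) list" where
  "oedge_list = concat (map (\<lambda>i. map (Pair i) (nbrs ! i)) [0..<20])"

text \<open>Mapping over the list keeps \<open>code_simp\<close> from unfolding nested
  walks with symbolic arguments, which is exponential.\<close>

lemma walk_table:
  "map walk (map walk (map walk (map walk (map walk oedge_list)))) = oedge_list"
  by code_simp

subsection \<open>Adjacency and rotation\<close>

text \<open>The bounds 2 < \<open>sqrt 5\<close> < 3 keep the six real values apart, so questions
  about inner products reduce to comparing integer pairs.\<close>

lemma rgold_cases:
  assumes "r \<in> set [(1, 0), (-1, 0), (-1, 2), (1, -2), (3, 0), (-3, 0)]"
  shows "rgold r \<in> {1, -1, 3, -3, sqrt 5, - sqrt 5}"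
    and "rgold r = 3 \<longleftrightarrow> r = (3, 0)" and "rgold r = -3 \<longleftrightarrow> r = (-3, 0)"
    and "rgold r = sqrt 5 \<longleftrightarrow> r = (-1, 2)"
proof -
  have s: "rgold (-1, 2) = sqrt 5" "rgold (1, -2) = - sqrt 5"
    by (simp_all add: gold_def add_divide_distrib)
  have "2 < sqrt (5::real)" "sqrt (5::real) < 3"
    by (simp_all add: real_less_rsqrt real_less_lsqrt)
  with assms s
  show "rgold r \<in> {1, -1, 3, -3, sqrt 5, - sqrt 5}"
    and "rgold r = 3 \<longleftrightarrow> r = (3, 0)" and "rgold r = -3 \<longleftrightarrow> r = (-3, 0)"
    and "rgold r = sqrt 5 \<longleftrightarrow> r = (-1, 2)"
    by auto
qed

lemma vtx_inner:
  assumes "i < 20" "j < 20"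
  shows "vtx i \<bullet> vtx j \<in> {1, -1, 3, -3, sqrt 5, - sqrt 5}"
    and "vtx i \<bullet> vtx j = 3 \<longleftrightarrow> i = j" and "vtx i \<bullet> vtx j = -3 \<longleftrightarrow> i + j = 19"
    and "vtx i \<bullet> vtx j = sqrt 5 \<longleftrightarrow> j \<in> set (nbrs ! i)"
proof -
  define r where "r = zinner (vertex_coords ! i) (vertex_coords ! j)"
  have r: "r \<in> set [(1, 0), (-1, 0), (-1, 2), (1, -2), (3, 0), (-3, 0)]"
    "(r = (3, 0) \<longleftrightarrow> i = j)" "(r = (-3, 0) \<longleftrightarrow> i + j = 19)"
    "(r = (-1, 2) \<longleftrightarrow> j \<in> set (nbrs ! i))"
    using vertex_table[unfolded Let_def, rule_format, of i j] assms unfolding r_def by auto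
  have "vtx i \<bullet> vtx j = rgold r"
    by (simp add: vtx_def r_def rgold_zinner)
  with rgold_cases[OF r(1)] r(2-4)
  show "vtx i \<bullet> vtx j \<in> {1, -1, 3, -3, sqrt 5, - sqrt 5}"
    and "vtx i \<bullet> vtx j = 3 \<longleftrightarrow> i = j" and "vtx i \<bullet> vtx j = -3 \<longleftrightarrow> i + j = 19"
    and "vtx i \<bullet> vtx j = sqrt 5 \<longleftrightarrow> j \<in> set (nbrs ! i)"
    by simp_all
qed

lemma vertex_cases:
  assumes "x \<in> dodeca_vertices"
  obtains i where "i < 20" "x = vtx i"
  using assms by (auto simp: dodeca_vertices_eq)

lemma vtx_in: "i < 20 \<Longrightarrow> vtx i \<in> dodeca_vertices"
  by (auto simp: dodeca_vertices_eq)

lemma finite_vertices: "finite dodeca_vertices"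
  by (simp add: dodeca_vertices_eq)

lemma vertex_inner_self: "x \<in> dodeca_vertices \<Longrightarrow> x \<bullet> x = 3"
  by (auto simp: dodeca_vertices_eq vtx_inner(2))

lemma vertex_inner_cases:
  "x \<in> dodeca_vertices \<Longrightarrow> y \<in> dodeca_vertices \<Longrightarrow>
    x \<bullet> y \<in> {1, -1, 3, -3, sqrt 5, - sqrt 5}"
  using vtx_inner(1) unfolding dodeca_vertices_eq by blast

lemma vtx_inject: "i < 20 \<Longrightarrow> j < 20 \<Longrightarrow> vtx i = vtx j \<longleftrightarrow> i = j"
  using vtx_inner(2)[of i j] vtx_inner(2)[of i i] by auto

lemma vertex_inner_eq_3:
  assumes "x \<in> dodeca_vertices" "y \<in> dodeca_vertices"
  shows "x \<bullet> y = 3 \<longleftrightarrow> x = y"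
  using assms by (auto simp: dodeca_vertices_eq vtx_inner(2) vtx_inject)

text \<open>All vertices have squared length 3, so \<open>x + y\<close> has squared length 3 + 3 - 6
  = 0.\<close>

lemma vertex_inner_eq_minus_3:
  assumes "x \<in> dodeca_vertices" "y \<in> dodeca_vertices" "x \<bullet> y = -3"
  shows "y = - x"
proof -
  have "(x + y) \<bullet> (x + y) = 0"
    using assms vertex_inner_self by (simp add: inner_add_left inner_add_right inner_commute)
  then show ?thesis
    by (simp add: eq_neg_iff_add_eq_0 add.commute)
qed

lemma vtx_minus: "i < 20 \<Longrightarrow> vtx (19 - i) = - vtx i"
  using vtx_inner(3)[of i "19 - i"] by (intro vertex_inner_eq_minus_3) (auto intro: vtx_in)

lemma vertex_minus:
  assumes "x \<in> dodeca_vertices"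
  shows "- x \<in> dodeca_vertices"
proof -
  obtain i where "i < 20" "x = vtx i"
    using assms by (rule vertex_cases)
  then show ?thesis
    using vtx_in[of "19 - i"] by (simp add: vtx_minus)
qed

lemma minus_vertex_iff [simp]: "- x \<in> dodeca_vertices \<longleftrightarrow> x \<in> dodeca_vertices"
  using vertex_minus[of x] vertex_minus[of "- x"] by auto

lemma vertex_neq_minus:
  assumes "x \<in> dodeca_vertices"
  shows "x \<noteq> - x"
proof
  assume "x = - x"
  then have "x \<bullet> x = - (x \<bullet> x)"
    by (metis inner_minus_left)
  then show False
    using assms by (simp add: vertex_inner_self)
qed

lemma dist_vertices:
  assumes "x \<in> dodeca_vertices" "y \<in> dodeca_vertices"
  shows "(dist x y)\<^sup>2 = 6 - 2 * (x \<bullet> y)"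
  using assms vertex_inner_self
  by (simp add: dist_norm power2_norm_eq_inner inner_diff_left inner_diff_right inner_commute)

lemma sqrt5_bounds: "2 < sqrt (5::real)" "sqrt (5::real) < 3"
  by (simp_all add: real_less_rsqrt real_less_lsqrt)

section \<open>Edges of the dodecahedron\<close>

lemma edge_len_eq: "edge_len = sqrt (6 - 2 * sqrt 5)"
  unfolding edge_len_def
proof (rule Min_eqI)
  have "{dist p q |p q. p \<in> dodeca_vertices \<and> q \<in> dodeca_vertices \<and> p \<noteq> q}
      \<subseteq> (\<lambda>(p, q). dist p q) ` (dodeca_vertices \<times> dodeca_vertices)"
    by auto
  then show "finite {dist p q |p q. p \<in> dodeca_vertices \<and> q \<in> dodeca_vertices \<and> p \<noteq> q}"
    by (rule finite_subset) (simp add: finite_vertices)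
next
  fix d assume "d \<in> {dist p q |p q. p \<in> dodeca_vertices \<and> q \<in> dodeca_vertices \<and> p \<noteq> q}"
  then obtain p q where d: "d = dist p q" "p \<in> dodeca_vertices" "q \<in> dodeca_vertices" "p \<noteq> q"
    by auto
  then have "p \<bullet> q \<le> sqrt 5"
    using vertex_inner_cases[of p q] vertex_inner_eq_3[of p q] sqrt5_bounds by auto
  then have "6 - 2 * sqrt 5 \<le> d\<^sup>2"
    using d dist_vertices[of p q] by simp
  then show "sqrt (6 - 2 * sqrt 5) \<le> d"
    using d by (simp add: real_le_lsqrt)
next
  \<comment> \<open>Vertices 0 and 4 are neighbours in the table and attain the bound.\<close>
  have "4 \<in> set (nbrs ! 0)" by (simp add: nbrs_def)
  then have "vtx 0 \<bullet> vtx 4 = sqrt 5" using vtx_inner(4)[of 0 4] by simp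
  then have "(dist (vtx 0) (vtx 4))\<^sup>2 = 6 - 2 * sqrt 5"
    using dist_vertices[of "vtx 0" "vtx 4"] vtx_in by simp
  then have "dist (vtx 0) (vtx 4) = sqrt (6 - 2 * sqrt 5)"
    by (metis real_sqrt_unique zero_le_dist)
  then show "sqrt (6 - 2 * sqrt 5)
      \<in> {dist p q |p q. p \<in> dodeca_vertices \<and> q \<in> dodeca_vertices \<and> p \<noteq> q}"
    using vtx_in[of 0] vtx_in[of 4] vtx_inject[of 0 4] by force
qed

lemma adj_iff_inner:
  "adj x y \<longleftrightarrow> x \<in> dodeca_vertices \<and> y \<in> dodeca_vertices \<and> x \<bullet> y = sqrt 5"
proof -
  have "dist x y = edge_len \<longleftrightarrow> x \<bullet> y = sqrt 5"
    if "x \<in> dodeca_vertices" "y \<in> dodeca_vertices"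
  proof -
    have "edge_len \<ge> 0" "edge_len\<^sup>2 = 6 - 2 * sqrt 5"
      using sqrt5_bounds by (simp_all add: edge_len_eq)
    then have "dist x y = edge_len \<longleftrightarrow> (dist x y)\<^sup>2 = 6 - 2 * sqrt 5"
      by (metis power2_eq_imp_eq zero_le_dist)
    then show ?thesis
      using dist_vertices[OF that] by simp
  qed
  moreover have "x \<bullet> y = sqrt 5 \<Longrightarrow> x \<in> dodeca_vertices \<Longrightarrow> x \<noteq> y"
    using sqrt5_bounds vertex_inner_self[of x] by auto
  ultimately show ?thesis
    unfolding adj_def by blast
qed

lemma adj_vtx: "i < 20 \<Longrightarrow> j < 20 \<Longrightarrow> adj (vtx i) (vtx j) \<longleftrightarrow> j \<in> set (nbrs ! i)"
  by (simp add: adj_iff_inner vtx_in vtx_inner(4))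

lemma nbrs_less: "i < 20 \<Longrightarrow> j \<in> set (nbrs ! i) \<Longrightarrow> j < 20"
  using nbrs_table by auto

lemma adj_cases:
  assumes "adj x y"
  obtains i j where "i < 20" "j \<in> set (nbrs ! i)" "x = vtx i" "y = vtx j"
  using assms adj_vtx unfolding adj_iff_inner by (metis vertex_cases adj_iff_inner)

section \<open>Cyclic order of the neighbours of a vertex\<close>

lemma nx_facts:
  assumes "i < 20" "j \<in> set (nbrs ! i)"
  shows "nx i j \<in> set (nbrs ! i)" "nx i j \<noteq> j" "nx i (nx i j) \<noteq> j" "nx i (nx i j) \<noteq> nx i j"
    "set (nbrs ! i) = {j, nx i j, nx i (nx i j)}" "nx i (nx i (nx i j)) = j"
    "nx (19 - i) (19 - j) = 19 - nx i (nx i j)"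
  using nbrs_table[rule_format, of i, THEN conjunct2, rule_format, of j] assms
  by auto

text \<open>Subtracting \<open>x\<close> only adds cross products having \<open>x\<close> as a
  factor, and these are orthogonal to \<open>x\<close>. Orientation can thus be tested on position
  vectors.\<close>

lemma cross3_diff_inner: "cross3 (y - x) (z - x) \<bullet> x = cross3 y z \<bullet> (x :: real^3)"
  by (simp add: cross3_def inner_vec_def sum_3 algebra_simps)

text \<open>Of the two other neighbours, one has triple product 2 and the other -2, so the sign
  selects exactly one.\<close>

lemma ccw_next_vtx:
  assumes "i < 20" "j \<in> set (nbrs ! i)"
  shows "ccw_next (vtx i) (vtx j) z \<longleftrightarrow> z = vtx (nx i j)"
proof -
  note nx = nx_facts[OF assms]
  have "zinner (zcross (vertex_coords ! j) (vertex_coords ! nx i j)) (vertex_coords ! i) = (2, 0)"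
    "zinner (zcross (vertex_coords ! j) (vertex_coords ! nx i (nx i j))) (vertex_coords ! i) = (-2, 0)"
    using nbrs_table[rule_format, of i, THEN conjunct2, rule_format, of j] assms
    by auto
  then have c: "cross3 (vtx j) (vtx (nx i j)) \<bullet> vtx i = 2"
    "cross3 (vtx j) (vtx (nx i (nx i j))) \<bullet> vtx i = -2"
    by (simp_all add: vtx_def flip: rpoint_zcross rgold_zinner)
  have l: "j < 20" "nx i j < 20" "nx i (nx i j) < 20"
    using nx nbrs_less[OF assms(1)] assms(2) by auto
  have "adj (vtx i) (vtx j)" "adj (vtx i) (vtx (nx i j))"
    using assms l nx by (auto simp: adj_vtx)
  then have 1: "ccw_next (vtx i) (vtx j) (vtx (nx i j))"
    using c l nx by (auto simp: ccw_next_def cross3_diff_inner vtx_inject)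
  moreover have "z = vtx (nx i j)" if z: "ccw_next (vtx i) (vtx j) z"
  proof -
    from z have "adj (vtx i) z" "z \<noteq> vtx j" by (auto simp: ccw_next_def)
    then obtain k where k: "k < 20" "z = vtx k" "k \<in> set (nbrs ! i)" "k \<noteq> j"
      using assms(1) by (metis adj_iff_inner adj_vtx vertex_cases)
    then have "k = nx i j \<or> k = nx i (nx i j)"
      using nx(5) by auto
    with z c k show ?thesis
      by (auto simp: ccw_next_def cross3_diff_inner)
  qed
  ultimately show ?thesis by blast
qed

lemma nxt_vtx: "i < 20 \<Longrightarrow> j \<in> set (nbrs ! i) \<Longrightarrow> nxt (vtx i) (vtx j) = vtx (nx i j)"
  unfolding nxt_def by (rule the_equality) (simp_all add: ccw_next_vtx)

lemma adj_in: "adj x y \<Longrightarrow> x \<in> dodeca_vertices" "adj x y \<Longrightarrow> y \<in> dodeca_vertices"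
  by (simp_all add: adj_iff_inner)

lemma adj_sym: "adj x y \<Longrightarrow> adj y x"
  by (simp add: adj_iff_inner inner_commute)

lemma adj_minus: "adj (- x) (- y) \<longleftrightarrow> adj x y"
  by (simp add: adj_iff_inner)

lemma adj_minus_left: "adj (- x) y \<longleftrightarrow> adj x (- y)"
  using adj_minus[of x "- y"] by simp

lemma adj_neq: "adj x y \<Longrightarrow> x \<noteq> y" "adj x y \<Longrightarrow> x \<noteq> - y"
proof -
  assume "adj x y"
  then have "x \<bullet> y = sqrt 5" "x \<bullet> x = 3" "y \<bullet> y = 3"
    using vertex_inner_self by (auto simp: adj_iff_inner)
  then show "x \<noteq> y" "x \<noteq> - y"
    using sqrt5_bounds by auto
qed

lemma nxt_facts:
  assumes "adj x y"
  shows "adj x (nxt x y)" "nxt x y \<noteq> y" "prv x y \<noteq> y" "prv x y \<noteq> nxt x y"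
    "{z. adj x z} = {y, nxt x y, prv x y}" "nxt x (prv x y) = y"
    "nxt (- x) (- y) = - prv x y"
proof -
  obtain i j where ij: "i < 20" "j \<in> set (nbrs ! i)" and xy: "x = vtx i" "y = vtx j"
    using assms by (rule adj_cases)
  note nx = nx_facts[OF ij] and less = nbrs_less[OF ij(1)]
  have nxt: "nxt x y = vtx (nx i j)" "prv x y = vtx (nx i (nx i j))"
    using ij nx xy by (simp_all add: prv_def nxt_vtx)
  have l: "j < 20" "nx i j < 20" "nx i (nx i j) < 20"
    using nx less ij(2) by auto
  show "adj x (nxt x y)" "nxt x y \<noteq> y" "prv x y \<noteq> y" "prv x y \<noteq> nxt x y"
    using nx l ij unfolding nxt unfolding xy by (auto simp: adj_vtx vtx_inject)
  show "nxt x (prv x y) = y"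
    using ij nx unfolding nxt unfolding xy by (auto simp: nxt_vtx)
  have "{z. adj x z} = vtx ` set (nbrs ! i)"
  proof (intro equalityI subsetI)
    fix z assume "z \<in> {z. adj x z}"
    then obtain k where "k < 20" "z = vtx k" "adj x z"
      by (auto simp: adj_iff_inner elim: vertex_cases)
    then show "z \<in> vtx ` set (nbrs ! i)"
      using ij xy by (simp add: adj_vtx)
  next
    fix z assume "z \<in> vtx ` set (nbrs ! i)"
    then show "z \<in> {z. adj x z}"
      using less ij xy by (auto simp: adj_vtx)
  qed
  also have "\<dots> = {y, nxt x y, prv x y}"
    unfolding nxt unfolding xy by (subst nx(5)) simp
  finally show "{z. adj x z} = {y, nxt x y, prv x y}" .
  have "19 - j \<in> set (nbrs ! (19 - i))"
    using adj_vtx[of "19 - i" "19 - j"] ij l assms xy by (simp add: vtx_minus adj_minus)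
  then have "nxt (vtx (19 - i)) (vtx (19 - j)) = vtx (nx (19 - i) (19 - j))"
    by (intro nxt_vtx) auto
  then show "nxt (- x) (- y) = - prv x y"
    using ij l unfolding nxt unfolding xy by (simp add: nx(7) vtx_minus)
qed

lemma adj_prv: "adj x y \<Longrightarrow> adj x (prv x y)"
  by (simp add: prv_def nxt_facts(1))

lemma prv_nxt: "adj x y \<Longrightarrow> prv x (nxt x y) = y"
  using nxt_facts(6)[of x y] by (simp add: prv_def)

lemma prv_prv: "adj x y \<Longrightarrow> prv x (prv x y) = nxt x y"
  using nxt_facts(6)[of x y] by (simp add: prv_def)

lemma prv_minus:
  assumes "adj x y"
  shows "prv (- x) (- y) = - nxt x y"
  using nxt_facts(7)[OF adj_prv[OF assms]] nxt_facts(7)[OF assms] prv_prv[OF assms]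
  by (simp add: prv_def)

lemma sum_nbrs:
  assumes "adj x y"
  shows "(\<Sum>z\<in>{z. adj x z}. f z) = f y + (f (nxt x y) + f (prv x y))"
proof -
  note n = nxt_facts[OF assms]
  have "(\<Sum>z\<in>{z. adj x z}. f z) = (\<Sum>z\<in>{y, nxt x y, prv x y}. f z)"
    using n(5) by simp
  also have "\<dots> = f y + (f (nxt x y) + f (prv x y))"
    using n(2-4) by (subst sum.insert; simp)+
  finally show ?thesis .
qed

text \<open>One step along the boundary of the face to the left of an oriented edge.\<close>

definition face_step :: "(real^3) \<times> (real^3) \<Rightarrow> (real^3) \<times> (real^3)" where
  "face_step p = (snd p, nxt (snd p) (fst p))"

lemma face_step_oedges: "p \<in> oedges \<Longrightarrow> face_step p \<in> oedges"
  by (auto simp: oedges_def face_step_def nxt_facts(1)[OF adj_sym])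

text \<open>Every face is a pentagon. The map \<open>g\<close> intertwines \<open>walk\<close> and
  \<open>face_step\<close>, which carries \<open>walk_table\<close> over to points.\<close>

lemma face_step_5:
  assumes "p \<in> oedges"
  shows "(face_step ^^ 5) p = p"
proof -
  define g where "g = (\<lambda>q. (vtx (fst q), vtx (snd q)))"
  have set: "set oedge_list = {(i, j). i < 20 \<and> j \<in> set (nbrs ! i)}"
    by (auto simp: oedge_list_def)
  obtain i j where ij: "i < 20" "j \<in> set (nbrs ! i)" "p = (vtx i, vtx j)"
    using assms by (auto simp: oedges_def elim: adj_cases)
  have step: "face_step (g q) = g (walk q)" "walk q \<in> set oedge_list"
    if q: "q \<in> set oedge_list" for q
  proof -
    obtain k l where kl: "q = (k, l)" "k < 20" "l \<in> set (nbrs ! k)"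
      using q unfolding set by auto
    then have "l < 20" by (auto intro: nbrs_less)
    moreover have "k \<in> set (nbrs ! l)"
      using kl \<open>l < 20\<close> by (metis adj_sym adj_vtx)
    ultimately show "face_step (g q) = g (walk q)" "walk q \<in> set oedge_list"
      using kl nx_facts(1)[of l k] unfolding set
      by (auto simp: face_step_def g_def walk_def nxt_vtx)
  qed
  have "(i, j) \<in> set oedge_list"
    using ij set by auto
  moreover have "walk (walk (walk (walk (walk q)))) = q" if "q \<in> set oedge_list" for q
    using walk_table that by (simp add: o_def map_idI list.map_comp map_eq_conv[of _ _ id, simplified])
  moreover have "p = g (i, j)"
    by (simp add: ij g_def)
  ultimately show ?thesis
    by (simp add: eval_nat_numeral step)
qed

lemma fwalk_eq: "fwalk a b k = (face_step ^^ k) (a, b)"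
  by (induction k) (simp_all add: face_step_def split: prod.split)

subsection \<open>Chains and cycles\<close>

lemma finite_nbrs [simp]: "finite {y. adj x y}"
  using finite_vertices by (rule rev_finite_subset) (auto dest: adj_in)

lemma oedges_Sigma: "oedges = (SIGMA x:dodeca_vertices. {y. adj x y})"
  by (auto simp: oedges_def dest: adj_in)

lemma finite_oedges [simp]: "finite oedges"
  by (simp add: oedges_Sigma finite_vertices)

lemma oedges_iff [simp]: "(x, y) \<in> oedges \<longleftrightarrow> adj x y"
  by (simp add: oedges_def)

lemma sum_oedges: "(\<Sum>p\<in>oedges. f p) = (\<Sum>x\<in>dodeca_vertices. \<Sum>y\<in>{y. adj x y}. f (x, y))"
  by (simp add: oedges_Sigma finite_vertices sum.Sigma)

lemma Ed_in_darts [simp]: "Ed x y \<in> darts \<longleftrightarrow> adj x y"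
  by (auto simp: darts_def)

lemma Tr_in_darts [simp]: "Tr x y z \<in> darts \<longleftrightarrow> adj x y \<and> adj x z \<and> y \<noteq> z"
  by (auto simp: darts_def)

lemma drev_drev [simp]: "drev (drev d) = d"
  by (cases d) simp_all

lemma diota_diota [simp]: "diota (diota d) = d"
  by (cases d) simp_all

lemma diota_drev: "diota (drev d) = drev (diota d)"
  by (cases d) simp_all

lemma drev_in_darts [simp]: "drev d \<in> darts \<longleftrightarrow> d \<in> darts"
  by (cases d) (auto dest: adj_sym)

lemma diota_in_darts [simp]: "diota d \<in> darts \<longleftrightarrow> d \<in> darts"
  by (cases d) (auto simp: adj_minus)

lemma drev_eq_iff: "drev d = d' \<longleftrightarrow> d = drev d'"
  by auto

lemma diota_eq_iff: "diota d = d' \<longleftrightarrow> d = diota d'"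
  by auto

lemma chain1_cell: "d \<in> darts \<Longrightarrow> chain1 (cell d)"
  by (auto simp: chain1_def cell_def drev_eq_iff diota_eq_iff diota_drev)

lemma chain1_add: "chain1 f \<Longrightarrow> chain1 g \<Longrightarrow> chain1 (\<lambda>d. f d + g d)"
  by (simp add: chain1_def)

lemma chain1_mult: "chain1 f \<Longrightarrow> chain1 (\<lambda>d. c * f d)"
  by (simp add: chain1_def)

lemma chain1_sum: "(\<And>i. i \<in> I \<Longrightarrow> chain1 (f i)) \<Longrightarrow> chain1 (\<lambda>d. \<Sum>i\<in>I. f i d)"
  by (simp add: chain1_def sum_negf)

lemma chain1_Tr_rev: "chain1 f \<Longrightarrow> f (Tr x z y) = - f (Tr x y z)"
  unfolding chain1_def by (metis drev.simps(2))

lemma chain1_Ed_rev: "chain1 f \<Longrightarrow> f (Ed y x) = - f (Ed x y)"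
  unfolding chain1_def by (metis drev.simps(1))

lemma chain1_Tr_minus: "chain1 f \<Longrightarrow> f (Tr (- x) (- y) (- z)) = f (Tr x y z)"
  unfolding chain1_def by (metis diota.simps(2))

lemma chain1_Tr_prv:
  assumes "chain1 f" "adj x y"
  shows "f (Tr x y (prv x y)) = - f (Tr x (prv x y) (nxt x (prv x y)))"
  using chain1_Tr_rev[OF assms(1), of x "prv x y" y] nxt_facts(6)[OF assms(2)] by simp

lemma nbr_cases:
  assumes "adj x y" "adj x z" "y \<noteq> z"
  shows "z = nxt x y \<or> z = prv x y"
proof -
  have "z \<in> {y, nxt x y, prv x y}"
    using assms(2) by (simp flip: nxt_facts(5)[OF assms(1)])
  then show ?thesis using assms(3) by auto
qed

text \<open>At a trivalent vertex every truncation dart runs counterclockwise or is the reverse of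
  one that does, so these values and the edge values determine a chain.\<close>

lemma chain1_eqI:
  assumes f: "chain1 f" and g: "chain1 g"
    and Ed: "\<And>x y. adj x y \<Longrightarrow> f (Ed x y) = g (Ed x y)"
    and Tr: "\<And>x y. adj x y \<Longrightarrow> f (Tr x y (nxt x y)) = g (Tr x y (nxt x y))"
  shows "f = g"
proof
  fix d
  show "f d = g d"
  proof (cases "d \<in> darts")
    case True
    then show ?thesis
    proof (cases d)
      case (Ed x y)
      with True assms(3) show ?thesis by simp
    next
      case (Tr x y z)
      with True nbr_cases consider "adj x y" "z = nxt x y" | "adj x y" "z = prv x y"
        by auto
      then show ?thesis
      proof cases
        case 1
        with assms(4) Tr show ?thesis by simp
      next
        case 2
        with assms(4)[of x "prv x y"] Tr show ?thesis
          by (simp add: chain1_Tr_prv[OF f] chain1_Tr_prv[OF g] adj_prv)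
      qed
    qed
  next
    case False
    with f g show ?thesis by (simp add: chain1_def)
  qed
qed

text \<open>The net outflow at the 0-cell of the corner \<open>(x, y)\<close>. As this corner is
  glued to \<open>(- x, - y)\<close>, the antipodal edge also starts there, while the truncation
  cells at \<open>- x\<close> are already those at \<open>x\<close>.\<close>

definition flow :: "(dart \<Rightarrow> int) \<Rightarrow> real^3 \<Rightarrow> real^3 \<Rightarrow> int" where
  "flow f x y = f (Ed x y) + f (Ed (- x) (- y)) + f (Tr x y (nxt x y)) + f (Tr x y (prv x y))"

text \<open>\<open>bdry\<close> sums over heads, which gives the minus sign. The 2 is both the
  explicit weight of edge darts and the number of darts representing one oriented truncation
  cell.\<close>

lemma bdry_eq_flow:
  assumes f: "chain1 f" and xy: "adj x y"
  shows "bdry f (x, y) = - 2 * flow f x y"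
proof -
  note n = nxt_facts[OF xy]
  have x: "x \<noteq> - x" "y \<noteq> - y"
    using vertex_neq_minus adj_in[OF xy] by blast+
  have "{d \<in> darts. is_edge_dart d \<and> same_pt (dhead d) (x, y)} = {Ed y x, Ed (- y) (- x)}"
  proof (intro equalityI subsetI)
    fix d assume "d \<in> {d \<in> darts. is_edge_dart d \<and> same_pt (dhead d) (x, y)}"
    then show "d \<in> {Ed y x, Ed (- y) (- x)}"
      by (cases d) (auto simp: same_pt_def)
  next
    fix d assume "d \<in> {Ed y x, Ed (- y) (- x)}"
    then show "d \<in> {d \<in> darts. is_edge_dart d \<and> same_pt (dhead d) (x, y)}"
      using xy by (auto simp: same_pt_def adj_minus dest: adj_sym)
  qed
  then have 1: "(\<Sum>d\<in>{d\<in>darts. is_edge_dart d \<and> same_pt (dhead d) (x, y)}. f d)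
      = f (Ed y x) + f (Ed (- y) (- x))"
    using x by simp
  have "{d \<in> darts. \<not> is_edge_dart d \<and> same_pt (dhead d) (x, y)}
      = {Tr x (nxt x y) y, Tr x (prv x y) y,
         Tr (- x) (- nxt x y) (- y), Tr (- x) (- prv x y) (- y)}"
  proof (intro equalityI subsetI)
    fix d assume d: "d \<in> {d \<in> darts. \<not> is_edge_dart d \<and> same_pt (dhead d) (x, y)}"
    then obtain u v w where d': "d = Tr u v w" "adj u v" "adj u w" "v \<noteq> w"
      and "(u, w) = (x, y) \<or> (u, w) = (- x, - y)"
      by (cases d) (auto simp: same_pt_def)
    then consider "u = x" "w = y" | "u = - x" "w = - y" by auto
    then show "d \<in> {Tr x (nxt x y) y, Tr x (prv x y) y,
         Tr (- x) (- nxt x y) (- y), Tr (- x) (- prv x y) (- y)}"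
    proof cases
      case 1
      with d' nbr_cases[of x y v] xy show ?thesis by auto
    next
      case 2
      with d' nbr_cases[of "- x" "- y" v] xy show ?thesis
        by (auto simp: adj_minus nxt_facts(7) prv_minus)
    qed
  next
    fix d assume "d \<in> {Tr x (nxt x y) y, Tr x (prv x y) y,
         Tr (- x) (- nxt x y) (- y), Tr (- x) (- prv x y) (- y)}"
    then show "d \<in> {d \<in> darts. \<not> is_edge_dart d \<and> same_pt (dhead d) (x, y)}"
      using xy n(1-3) adj_prv[OF xy] by (auto simp: same_pt_def adj_minus)
  qed
  then have 2: "(\<Sum>d\<in>{d\<in>darts. \<not> is_edge_dart d \<and> same_pt (dhead d) (x, y)}. f d)
      = 2 * f (Tr x (nxt x y) y) + 2 * f (Tr x (prv x y) y)"
    using x n(2-4) by (simp add: chain1_Tr_minus[OF f])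
  show ?thesis
    unfolding bdry_def 1 2 flow_def
    using chain1_Ed_rev[OF f, of y x] chain1_Ed_rev[OF f, of "- y" "- x"]
      chain1_Tr_rev[OF f, of x y]
    by simp
qed

lemma Z1_iff_flow: "Z1 f \<longleftrightarrow> chain1 f \<and> (\<forall>x y. adj x y \<longrightarrow> flow f x y = 0)"
  unfolding Z1_def by (auto simp: oedges_def bdry_eq_flow)

lemma Z1_chain1: "Z1 f \<Longrightarrow> chain1 f"
  by (simp add: Z1_def)

lemma Z1_flow: "Z1 f \<Longrightarrow> adj x y \<Longrightarrow> flow f x y = 0"
  by (simp add: Z1_iff_flow)

lemma Z1_add: "Z1 f \<Longrightarrow> Z1 g \<Longrightarrow> Z1 (\<lambda>d. f d + g d)"
  unfolding Z1_iff_flow by (fastforce simp: flow_def intro: chain1_add)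

lemma Z1_mult: "Z1 f \<Longrightarrow> Z1 (\<lambda>d. c * f d)"
  unfolding Z1_iff_flow by (auto simp: flow_def simp flip: distrib_left intro: chain1_mult)

lemma Z1_sum: "(\<And>i. i \<in> I \<Longrightarrow> Z1 (f i)) \<Longrightarrow> Z1 (\<lambda>d. \<Sum>i\<in>I. f i d)"
  unfolding Z1_iff_flow by (auto simp: flow_def simp flip: sum.distrib intro: chain1_sum)

lemma homologous_refl: "Z1 f \<Longrightarrow> homologous f f"
  unfolding homologous_def by (auto intro!: exI[of _ "\<lambda>_. 0"])

section \<open>Values of cells, of vanishing cycles, and of \<open>u_trc\<close> and
  \<open>u_edge\<close>\<close>

lemma cell_Ed_Ed: "cell (Ed u v) (Ed x y) = of_bool (x = u \<and> y = v) - of_bool (x = v \<and> y = u)"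
  by (simp add: cell_def of_bool_def)

lemma cell_Ed_Tr [simp]: "cell (Ed u v) (Tr x y z) = 0"
  by (simp add: cell_def)

lemma cell_Tr_Ed [simp]: "cell (Tr x y z) (Ed u v) = 0"
  by (simp add: cell_def)

text \<open>Reversal turns a counterclockwise truncation dart into a clockwise one, and so does the
  antipodal map. Only both together give a counterclockwise dart again, and there the cell has value
  -1.\<close>

lemma cell_Tr_Tr:
  assumes "adj u v" "adj x y"
  shows "cell (Tr u v (nxt u v)) (Tr x y (nxt x y))
    = of_bool (u = x \<and> v = y) - of_bool (u = - x \<and> v = - nxt x y)"
proof -
  have 1: "Tr x y (nxt x y) = Tr u v (nxt u v) \<longleftrightarrow> u = x \<and> v = y"
    by auto
  have 2: "Tr x y (nxt x y) \<noteq> Tr (- u) (- v) (- nxt u v)"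
    using nxt_facts(7)[OF assms(1)] nxt_facts(4)[OF assms(1)] by auto
  have 3: "Tr x y (nxt x y) \<noteq> Tr u (nxt u v) v"
    using nxt_facts(3)[OF assms(1)] by (auto simp: prv_def)
  have 4: "Tr x y (nxt x y) = Tr (- u) (- nxt u v) (- v) \<longleftrightarrow> u = - x \<and> v = - nxt x y"
    using prv_minus[OF assms(2)] nxt_facts(6)[of "- x" "- y"] nxt_facts(7)[OF assms(2)] assms
      prv_nxt[OF assms(2)] nxt_facts(7)[OF nxt_facts(1)[OF assms(2)]]
    by (auto simp: adj_minus)
  show ?thesis
    by (simp only: cell_def diota.simps drev.simps insert_iff empty_iff 1 2 3 4 of_bool_def
        HOL.simp_thms)
qed

lemma chain1_delta_trc: "chain1 (delta_trc x)"
  unfolding delta_trc_def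
  by (intro chain1_sum chain1_cell) (metis (no_types) Tr_in_darts mem_Collect_eq nxt_facts(1,2))

lemma chain1_delta_edge: "adj x y \<Longrightarrow> chain1 (delta_edge x y)"
  unfolding delta_edge_def
  by (intro chain1_add chain1_cell) (auto simp: adj_minus dest: adj_sym)

text \<open>The odd function \<sigma> of the opening comment.\<close>

definition osgn :: "'a :: uminus set \<Rightarrow> 'a \<Rightarrow> int" where
  "osgn E x = of_bool (x \<in> E) - of_bool (- x \<in> E)"

lemma osgn_minus: "osgn E (- x) = - osgn E (x :: 'a :: group_add)"
  by (simp add: osgn_def)

lemma delta_trc_Ed [simp]: "delta_trc x (Ed u v) = 0"
  by (simp add: delta_trc_def)

lemma delta_trc_Tr:
  assumes "u \<in> dodeca_vertices" "adj x y"
  shows "delta_trc u (Tr x y (nxt x y)) = osgn {u} x"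
proof -
  have "delta_trc u (Tr x y (nxt x y))
      = (\<Sum>v\<in>{v. adj u v}. of_bool (u = x \<and> v = y) - of_bool (u = - x \<and> v = - nxt x y))"
    unfolding delta_trc_def by (intro sum.cong refl cell_Tr_Tr) (use assms in auto)
  also have "\<dots> = (\<Sum>v\<in>{v. adj u v}. if v = y then of_bool (u = x) else 0)
      - (\<Sum>v\<in>{v. adj u v}. if v = - nxt x y then of_bool (u = - x) else 0)"
    unfolding sum_subtractf[symmetric] by (intro sum.cong) auto
  also have "(\<Sum>v\<in>{v. adj u v}. if v = y then of_bool (u = x) else 0) = (of_bool (x \<in> {u}) :: int)"
    using assms(2) by auto
  also have "(\<Sum>v\<in>{v. adj u v}. if v = - nxt x y then of_bool (u = - x) else 0)
      = (of_bool (- x \<in> {u}) :: int)"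
    using nxt_facts(1)[OF assms(2)] by (auto simp: adj_minus)
  also note osgn_def[symmetric]
  finally show ?thesis .
qed

lemma delta_edge_Tr [simp]: "delta_edge u v (Tr x y z) = 0"
  by (simp add: delta_edge_def)

lemma delta_edge_Ed:
  "delta_edge u v (Ed x y) = of_bool (x = u \<and> y = v) - of_bool (x = v \<and> y = u)
     + of_bool (x = - v \<and> y = - u) - of_bool (x = - u \<and> y = - v)"
  by (simp add: delta_edge_def cell_Ed_Ed)

lemma Z1_delta_trc:
  assumes "x \<in> dodeca_vertices"
  shows "Z1 (delta_trc x)"
  unfolding Z1_iff_flow
proof (intro conjI allI impI)
  fix u v assume uv: "adj u v"
  then show "flow (delta_trc x) u v = 0"
    using assms by (simp add: flow_def chain1_Tr_prv[OF chain1_delta_trc] delta_trc_Tr adj_prv)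
qed (rule chain1_delta_trc)

text \<open>The loop consists of \<open>Ed u v\<close> and \<open>Ed (- v) (- u)\<close>, so the
  antipodal map reverses its direction.\<close>

lemma delta_edge_Ed_minus: "delta_edge u v (Ed (- x) (- y)) = - delta_edge u v (Ed x y)"
proof -
  have e: "- a = b \<longleftrightarrow> a = - b" for a b :: "real^3"
    by auto
  show ?thesis
    unfolding delta_edge_Ed e minus_minus by linarith
qed

lemma Z1_delta_edge:
  assumes "adj x y"
  shows "Z1 (delta_edge x y)"
  unfolding Z1_iff_flow
  using chain1_delta_edge[OF assms] by (simp add: flow_def delta_edge_Ed_minus)

lemma Z1_u_trc: "E \<subseteq> dodeca_vertices \<Longrightarrow> Z1 (u_trc E)"
  unfolding u_trc_def by (intro Z1_sum Z1_delta_trc) auto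

lemma Z1_u_edge: "Z1 (u_edge E)"
  unfolding u_edge_def by (intro Z1_sum Z1_delta_edge) auto

lemma u_trc_Ed [simp]: "u_trc E (Ed x y) = 0"
  by (simp add: u_trc_def)

lemma u_trc_Tr:
  assumes "E \<subseteq> dodeca_vertices" "adj x y"
  shows "u_trc E (Tr x y (nxt x y)) = osgn E x"
proof -
  have fin: "finite E"
    using assms(1) finite_vertices by (rule finite_subset)
  have "u_trc E (Tr x y (nxt x y)) = (\<Sum>u\<in>E. osgn {u} x)"
    unfolding u_trc_def by (intro sum.cong refl delta_trc_Tr) (use assms in auto)
  also have "\<dots> = osgn E x"
    using fin by (simp add: osgn_def of_bool_def sum_subtractf eq_commute[of _ "- x"])
  finally show ?thesis .
qed

lemma u_edge_Tr [simp]: "u_edge E (Tr x y z) = 0"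
  by (simp add: u_edge_def)

lemma u_edge_Ed:
  assumes "E \<subseteq> dodeca_vertices" "adj x y"
  shows "u_edge E (Ed x y) = osgn E x - osgn E y"
proof -
  have fin: "finite E"
    using assms(1) finite_vertices by (rule finite_subset)
  \<comment> \<open>A condition that fixes the oriented edge leaves a single term, present when its
    initial vertex lies in \<open>E\<close>.\<close>
  have pick: "(\<Sum>u\<in>E. \<Sum>v\<in>{v. adj u v}. of_bool (P u v)) = (of_bool (a \<in> E) :: int)"
    if "adj a b" "\<And>u v. P u v \<longleftrightarrow> u = a \<and> v = b" for a b P
  proof -
    have "(\<Sum>v\<in>{v. adj u v}. of_bool (P u v)) = (if u = a then 1 else (0 :: int))" for u
      using that by (auto simp: of_bool_conj of_bool_def)
    then show ?thesis using fin by (simp add: of_bool_def)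
  qed
  have "(\<Sum>u\<in>E. \<Sum>v\<in>{v. adj u v}. of_bool (x = u \<and> y = v)) = (of_bool (x \<in> E) :: int)"
    "(\<Sum>u\<in>E. \<Sum>v\<in>{v. adj u v}. of_bool (x = v \<and> y = u)) = (of_bool (y \<in> E) :: int)"
    "(\<Sum>u\<in>E. \<Sum>v\<in>{v. adj u v}. of_bool (x = - v \<and> y = - u)) = (of_bool (- y \<in> E) :: int)"
    "(\<Sum>u\<in>E. \<Sum>v\<in>{v. adj u v}. of_bool (x = - u \<and> y = - v)) = (of_bool (- x \<in> E) :: int)"
    subgoal by (rule pick[of x y]) (use assms(2) in auto)
    subgoal by (rule pick[of y x]) (use adj_sym[OF assms(2)] in auto)
    subgoal by (rule pick[of "- y" "- x"]) (use adj_sym[OF assms(2)] in \<open>auto simp: adj_minus\<close>)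
    subgoal by (rule pick[of "- x" "- y"]) (use assms(2) in \<open>auto simp: adj_minus\<close>)
    done
  then show ?thesis
    unfolding u_edge_def delta_edge_Ed osgn_def by (simp only: sum_subtractf sum.distrib)
qed

subsection \<open>Intersection numbers and Picard-Lefschetz operators\<close>

lemma sum_oedges_flip: "(\<Sum>(x, y)\<in>oedges. f y x) = (\<Sum>(x, y)\<in>oedges. f x y)"
  by (rule sum.reindex_bij_witness[of _ prod.swap prod.swap]) (auto dest: adj_sym)

lemma sum_vertices_minus: "(\<Sum>x\<in>dodeca_vertices. f (- x)) = (\<Sum>x\<in>dodeca_vertices. f x)"
  by (rule sum.reindex_bij_witness[of _ uminus uminus]) auto

lemma sum_nbrs_minus: "(\<Sum>y\<in>{y. adj (- x) y}. f y) = (\<Sum>y\<in>{y. adj x y}. f (- y))"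
  by (rule sum.reindex_bij_witness[of _ uminus uminus]) (auto simp: adj_minus_left)

text \<open>Add the balance over the three corners at \<open>x\<close>: each truncation cell leaves
  one corner and enters the next, so only the edge values survive.\<close>

lemma sum_flow:
  assumes "Z1 a" "x \<in> dodeca_vertices"
  shows "(\<Sum>y\<in>{y. adj x y}. a (Ed (- x) (- y))) = - (\<Sum>y\<in>{y. adj x y}. a (Ed x y))"
proof -
  have a: "chain1 a" using assms(1) by (rule Z1_chain1)
  have "0 = (\<Sum>y\<in>{y. adj x y}. flow a x y)"
    using Z1_flow[OF assms(1)] by simp
  also have "\<dots> = (\<Sum>y\<in>{y. adj x y}. a (Ed x y)) + (\<Sum>y\<in>{y. adj x y}. a (Ed (- x) (- y)))
      + ((\<Sum>y\<in>{y. adj x y}. a (Tr x y (nxt x y))) + (\<Sum>y\<in>{y. adj x y}. a (Tr x y (prv x y))))"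
    by (simp only: flow_def sum.distrib add.assoc)
  also have "(\<Sum>y\<in>{y. adj x y}. a (Tr x y (prv x y))) = (\<Sum>y\<in>{y. adj x y}. - a (Tr x y (nxt x y)))"
    by (rule sum.reindex_bij_witness[of _ "nxt x" "prv x"])
      (auto simp: nxt_facts(1,6) adj_prv prv_nxt chain1_Tr_prv[OF a])
  finally show ?thesis by (simp add: sum_negf)
qed

text \<open>In the local formula at a corner, \<open>b\<close> has the outflows \<open>- s, u, s, - u\<close>; as the four outflows
  of the cycle \<open>a\<close> add up to \<open>0\<close>, only two differences of them survive.\<close>

lemma int4_eq:
  assumes a: "Z1 a" and b: "chain1 b"
    and e: "\<And>x y. adj x y \<Longrightarrow> b (Ed (- x) (- y)) = - b (Ed x y)"
    and t: "\<And>x y. adj x y \<Longrightarrow> b (Tr x y (prv x y)) = - b (Tr x y (nxt x y))"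
  shows "int4 a b = (\<Sum>(x, y)\<in>oedges.
      b (Tr x y (nxt x y)) * (a (Ed x y) - a (Ed (- x) (- y)))
      + b (Ed x y) * (a (Tr x y (prv x y)) - a (Tr x y (nxt x y))))"
proof -
  have i: "(\<Sum>i<4. \<Sum>j<4. if i < j then p i * q j - p j * q i else 0)
      = (p 0 * q 1 - p 1 * q 0) + (p 0 * q 2 - p 2 * q 0) + (p 0 * q 3 - p 3 * q 0)
      + (p 1 * q 2 - p 2 * q 1) + (p 1 * q 3 - p 3 * q 1) + (p 2 * q 3 - p 3 * (q 2 :: int))"
    for p q :: "nat \<Rightarrow> int"
    by (simp add: eval_nat_numeral)
  have alg: "(a0 * u - a1 * (- s)) + (a0 * s - a2 * (- s)) + (a0 * (- u) - a3 * (- s))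
      + (a1 * s - a2 * u) + (a1 * (- u) - a3 * u) + (a2 * (- u) - a3 * s)
      = s * (a1 - a3) + u * (a0 - a2)"
    if "a1 + a3 + a2 + a0 = 0" for a0 a1 a2 a3 s u :: int
  proof -
    have a3: "a3 = - a0 - a1 - a2" using that by simp
    show ?thesis unfolding a3 by (simp add: algebra_simps)
  qed
  show ?thesis
    unfolding int4_def Let_def
  proof (rule sum.cong[OF refl], clarify)
    fix x y assume "(x, y) \<in> oedges"
    then have xy: "adj x y" by simp
    show "(\<Sum>i<4. \<Sum>j<4. if i < j
        then a (rot (fst (x, y)) (snd (x, y)) ! i) * b (rot (fst (x, y)) (snd (x, y)) ! j)
          - a (rot (fst (x, y)) (snd (x, y)) ! j) * b (rot (fst (x, y)) (snd (x, y)) ! i) else 0)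
      = b (Tr x y (nxt x y)) * (a (Ed x y) - a (Ed (- x) (- y)))
      + b (Ed x y) * (a (Tr x y (prv x y)) - a (Tr x y (nxt x y)))"
      unfolding i
      using alg[of "a (Ed x y)" "a (Ed (- x) (- y))" "a (Tr x y (nxt x y))" "a (Tr x y (prv x y))"
          "b (Ed x y)" "b (Tr x y (nxt x y))"] Z1_flow[OF a xy]
      by (simp add: rot_def flow_def e[OF xy] t[OF xy])
  qed
qed

text \<open>The cycle is met at the corners of \<open>x\<close> and again at those of
  \<open>- x\<close>, and \<open>sum_flow\<close> doubles the edge outflow once more. Together this
  is the factor 4 built into \<open>int4\<close>.\<close>

lemma int4_delta_trc:
  assumes a: "Z1 a" and x: "x \<in> dodeca_vertices"
  shows "int4 a (delta_trc x) = 4 * (\<Sum>y\<in>{y. adj x y}. a (Ed x y))"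
proof -
  define f where "f u = (\<Sum>v\<in>{v. adj u v}. a (Ed u v) - a (Ed (- u) (- v)))" for u
  have f: "f u = 2 * (\<Sum>v\<in>{v. adj u v}. a (Ed u v))" if "u \<in> dodeca_vertices" for u
    using sum_flow[OF a that] by (simp add: f_def sum_subtractf)
  have "int4 a (delta_trc x) = (\<Sum>(u, v)\<in>oedges. osgn {x} u * (a (Ed u v) - a (Ed (- u) (- v))))"
    by (subst int4_eq[OF a chain1_delta_trc])
      (auto simp: delta_trc_Tr[OF x] chain1_Tr_prv[OF chain1_delta_trc] adj_prv
        simp del: of_bool_eq_iff intro!: sum.cong)
  also have "\<dots> = (\<Sum>u\<in>dodeca_vertices. osgn {x} u * f u)"
    by (simp add: sum_oedges f_def sum_distrib_left)
  also have "\<dots> = (\<Sum>u\<in>dodeca_vertices. of_bool (u = x) * f u)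
      - (\<Sum>u\<in>dodeca_vertices. of_bool (- u = x) * f u)"
    by (simp add: osgn_def left_diff_distrib sum_subtractf)
  also have "(\<Sum>u\<in>dodeca_vertices. of_bool (- u = x) * f u)
      = (\<Sum>u\<in>dodeca_vertices. of_bool (u = x) * f (- u))"
    using sum_vertices_minus[of "\<lambda>u. of_bool (u = x) * f (- u)"] by simp
  also have "(\<Sum>u\<in>dodeca_vertices. of_bool (u = x) * f u)
      - (\<Sum>u\<in>dodeca_vertices. of_bool (u = x) * f (- u)) = f x - f (- x)"
    using x by (simp add: of_bool_def if_distrib[of "\<lambda>c. c * _"] finite_vertices cong: if_cong)
  also have "f (- x) = - f x"
    by (simp add: f_def sum_nbrs_minus sum_subtractf)
  finally show ?thesis using f[OF x] by simp
qed

lemma int4_delta_edge: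
  assumes a: "Z1 a" and uv: "adj u v"
  shows "int4 a (delta_edge u v) = 4 * (a (Tr u v (prv u v)) + a (Tr v u (nxt v u)))"
proof -
  define A where "A p = a (Tr (fst p) (snd p) (prv (fst p) (snd p)))
      - a (Tr (fst p) (snd p) (nxt (fst p) (snd p)))" for p
  have vu: "adj v u" using uv by (rule adj_sym)
  have c: "chain1 a" using a by (rule Z1_chain1)
  have pick: "(\<Sum>p\<in>oedges. of_bool (p = q) * A p) = A q" if "q \<in> oedges" for q
    using that by (simp add: of_bool_def if_distrib[of "\<lambda>c. c * _"] cong: if_cong)
  have A: "A (- x, - y) = - A (x, y)" if "adj x y" for x y
    by (simp add: A_def nxt_facts(7)[OF that] prv_minus[OF that] chain1_Tr_minus[OF c])
  have "int4 a (delta_edge u v) = (\<Sum>p\<in>oedges. (of_bool (p = (u, v)) - of_bool (p = (v, u))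
      + of_bool (p = (- v, - u)) - of_bool (p = (- u, - v))) * A p)"
    unfolding int4_eq[OF a chain1_delta_edge[OF uv] delta_edge_Ed_minus, simplified]
    by (simp add: delta_edge_Ed A_def case_prod_unfold prod_eq_iff)
  also have "\<dots> = A (u, v) - A (v, u) + A (- v, - u) - A (- u, - v)"
    using uv vu by (simp only: left_diff_distrib distrib_right sum_subtractf sum.distrib pick
        oedges_iff adj_minus)
  also have "\<dots> = 2 * A (u, v) - 2 * A (v, u)"
    using A[OF uv] A[OF vu] by simp
  also have "\<dots> = 4 * (a (Tr u v (prv u v)) + a (Tr v u (nxt v u)))"
  proof -
    \<comment> \<open>In the sum of the two balances the edge values cancel, so the four truncation
      values add up to 0: the pair on the face to the right of \<open>(u, v)\<close> is minus the
      pair on the face to the left.\<close>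
    have "flow a u v + flow a v u = 0"
      using Z1_flow[OF a] uv vu by simp
    then show ?thesis
      using chain1_Ed_rev[OF c, of u v] chain1_Ed_rev[OF c, of "- u" "- v"]
      by (simp add: flow_def A_def)
  qed
  finally show ?thesis .
qed

section \<open>Picard-Lefschetz sums over the vanishing cycles\<close>

lemma int4_minus_right: "int4 a (\<lambda>d. - b d) = - int4 a b"
  unfolding int4_def Let_def
  by (simp only: sum_negf[symmetric] if_distrib[of uminus] mult_minus_right minus_diff_eq
      minus_zero minus_diff_minus)

text \<open>\<open>intsec\<close> is an integer division, which commutes with the change of sign
  here because \<open>int4\<close> is divisible by 4.\<close>

lemma intsec_eqI:
  assumes "int4 a b = 4 * k"
  shows "intsec a b = k" "intsec a (\<lambda>d. - b d) = - k"
proof -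
  show "intsec a b = k"
    using assms by (simp add: intsec_def)
  have "int4 a (\<lambda>d. - b d) = 4 * (- k)"
    using assms by (simp add: int4_minus_right)
  then show "intsec a (\<lambda>d. - b d) = - k"
    by (simp only: intsec_def nonzero_mult_div_cancel_left[of 4] numeral_neq_zero not_False_eq_True)
qed

text \<open>Replacing \<delta> by its negative leaves a summand unchanged, so every representative
  that \<open>SOME\<close> may choose gives the same term. Summing over the indices counts each
  class \<open>m\<close> times.\<close>

lemma PL_image:
  assumes I: "finite I"
    and k: "\<And>i. i \<in> I \<Longrightarrow> int4 h (f i) = 4 * k i"
    and m: "\<And>i. i \<in> I \<Longrightarrow> card {j \<in> I. f j = f i \<or> f j = (\<lambda>d. - f i d)} = m"
  shows "int m * (PL (f ` I) h d - h d) = (\<Sum>i\<in>I. k i * f i d)"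
proof -
  define q where "q i = {f i, (\<lambda>d. - f i d)}" for i
  define H where "H C = (let \<delta> = SOME \<delta>. \<delta> \<in> C in intsec h \<delta> * \<delta> d)" for C
  have H: "H (q i) = k i * f i d" if "i \<in> I" for i
  proof -
    have "(SOME \<delta>. \<delta> \<in> q i) \<in> q i"
      by (rule someI[of _ "f i"]) (simp add: q_def)
    then consider "(SOME \<delta>. \<delta> \<in> q i) = f i" | "(SOME \<delta>. \<delta> \<in> q i) = (\<lambda>d. - f i d)"
      by (auto simp: q_def)
    then show ?thesis
      by cases (simp_all add: H_def intsec_eqI[OF k[OF that]])
  qed
  have q: "q j = q i \<longleftrightarrow> f j = f i \<or> f j = (\<lambda>d. - f i d)" for i j
    by (auto simp: q_def doubleton_eq_iff fun_eq_iff)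
  have "(\<Sum>i\<in>I. H (q i)) = (\<Sum>C\<in>q ` I. \<Sum>i\<in>{i \<in> I. q i = C}. H (q i))"
    using I by (rule sum.image_gen)
  also have "\<dots> = (\<Sum>C\<in>q ` I. int m * H C)"
  proof (rule sum.cong[OF refl])
    fix C assume "C \<in> q ` I"
    then obtain i where i: "i \<in> I" "C = q i" by auto
    have "(\<Sum>j\<in>{j \<in> I. q j = C}. H (q j)) = (\<Sum>j\<in>{j \<in> I. q j = C}. H C)"
      by (rule sum.cong) auto
    also have "\<dots> = int m * H C"
      using m[OF i(1)] by (simp add: i(2) q)
    finally show "(\<Sum>j\<in>{j \<in> I. q j = C}. H (q j)) = int m * H C" .
  qed
  also have "\<dots> = int m * (PL (f ` I) h d - h d)"
    by (simp add: PL_def image_image q_def H_def sum_distrib_left)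
  finally show ?thesis
    using H by simp
qed

text \<open>By oddness the contribution of \<open>- E\<close> equals that of
  \<open>E\<close>.\<close>

lemma osgn_vertices_sum:
  assumes "E \<subseteq> dodeca_vertices" and f: "\<And>x. x \<in> dodeca_vertices \<Longrightarrow> f (- x) = - (f x :: int)"
  shows "(\<Sum>x\<in>dodeca_vertices. osgn E x * f x) = 2 * (\<Sum>x\<in>E. f x)"
proof -
  have s: "(\<Sum>x\<in>dodeca_vertices. of_bool (x \<in> E) * f x) = (\<Sum>x\<in>E. f x)"
    using assms(1) finite_vertices
    by (simp add: of_bool_def if_distrib[of "\<lambda>c. c * _"] sum.If_cases Int_absorb1 cong: if_cong)
  have "(\<Sum>x\<in>dodeca_vertices. osgn E x * f x)
      = (\<Sum>x\<in>dodeca_vertices. of_bool (x \<in> E) * f x) - (\<Sum>x\<in>dodeca_vertices. of_bool (- x \<in> E) * f x)"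
    by (simp add: osgn_def left_diff_distrib sum_subtractf)
  also have "(\<Sum>x\<in>dodeca_vertices. of_bool (- x \<in> E) * f x)
      = (\<Sum>x\<in>dodeca_vertices. of_bool (x \<in> E) * f (- x))"
    using sum_vertices_minus[of "\<lambda>x. of_bool (x \<in> E) * f (- x)"] by simp
  also have "\<dots> = - (\<Sum>x\<in>dodeca_vertices. of_bool (x \<in> E) * f x)"
    using f by (simp add: sum_negf)
  finally show ?thesis by (simp add: s)
qed

lemma vertex_has_nbr:
  assumes "x \<in> dodeca_vertices"
  obtains y where "adj x y"
proof -
  obtain i where i: "i < 20" "x = vtx i" using assms by (rule vertex_cases)
  have "nbrs ! i ! 0 \<in> set (nbrs ! i)"
    using nbrs_table i by auto
  with i show thesis
    using that[of "vtx (nbrs ! i ! 0)"] nbrs_less adj_vtx by blast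
qed

lemma chain1_uminus: "chain1 f \<Longrightarrow> chain1 (\<lambda>d. - f d)"
  using chain1_mult[of f "-1"] by simp

lemma delta_trc_minus:
  assumes "x \<in> dodeca_vertices"
  shows "delta_trc (- x) = (\<lambda>d. - delta_trc x d)"
proof (rule chain1_eqI)
  fix u v assume "adj u v"
  then have "delta_trc (- x) (Tr u v (nxt u v)) = osgn {- x} u"
    "delta_trc x (Tr u v (nxt u v)) = osgn {x} u"
    using assms by (auto intro!: delta_trc_Tr)
  moreover have "osgn {- x} u = - osgn {x} u"
    unfolding osgn_def by (auto simp del: of_bool_eq_iff)
  ultimately show "delta_trc (- x) (Tr u v (nxt u v)) = - delta_trc x (Tr u v (nxt u v))"
    by simp
qed (simp_all add: chain1_delta_trc chain1_uminus)

lemma delta_trc_inject: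
  assumes "x \<in> dodeca_vertices" "y \<in> dodeca_vertices" "delta_trc x = delta_trc y"
  shows "x = y"
proof -
  obtain v where "adj y v" using assms(2) by (rule vertex_has_nbr)
  then have "osgn {x} y = osgn {y} y"
    using assms delta_trc_Tr by metis
  then show ?thesis
    using vertex_neq_minus[OF assms(2)] by (auto simp: osgn_def of_bool_def split: if_splits)
qed

text \<open>A class of vanishing cycles has the two indices \<open>x\<close> and \<open>- x\<close>;
  this 2 cancels against the one in \<open>osgn_vertices_sum\<close>. With \<open>{}\<close> in
  place of \<open>E\<close> the lemma becomes a criterion for \<open>h\<close> to be fixed.\<close>

lemma rho_trc_eq:
  assumes h: "Z1 h" and E: "E \<subseteq> dodeca_vertices"
    and s: "\<And>x. x \<in> dodeca_vertices \<Longrightarrow> (\<Sum>y\<in>{y. adj x y}. h (Ed x y)) = osgn E x"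
  shows "rho_trc h = (\<lambda>d. h d + u_trc E d)"
proof
  fix d
  have "int 2 * (PL (delta_trc ` dodeca_vertices) h d - h d)
      = (\<Sum>x\<in>dodeca_vertices. osgn E x * delta_trc x d)"
  proof (rule PL_image[OF finite_vertices])
    fix x assume x: "x \<in> dodeca_vertices"
    show "int4 h (delta_trc x) = 4 * osgn E x"
      using int4_delta_trc[OF h x] s[OF x] by simp
    have "{y \<in> dodeca_vertices. delta_trc y = delta_trc x \<or> delta_trc y = (\<lambda>d. - delta_trc x d)}
        = {x, - x}"
      using x delta_trc_minus[OF x] delta_trc_inject[OF _ x] delta_trc_inject[of _ "- x"] by auto
    then show "card {y \<in> dodeca_vertices.
        delta_trc y = delta_trc x \<or> delta_trc y = (\<lambda>d. - delta_trc x d)} = 2"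
      using vertex_neq_minus[OF x] by (simp only: card_2_iff) blast
  qed
  also have "\<dots> = 2 * u_trc E d"
    unfolding u_trc_def by (rule osgn_vertices_sum[OF E]) (simp add: delta_trc_minus)
  finally show "rho_trc h d = h d + u_trc E d"
    by (simp add: rho_trc_def Delta_trc_def)
qed

lemma delta_edge_flip: "delta_edge y x = (\<lambda>d. - delta_edge x y d)"
  by (rule ext, rename_tac d, case_tac d) (simp_all add: delta_edge_Ed)

lemma delta_edge_minus: "delta_edge (- x) (- y) = (\<lambda>d. - delta_edge x y d)"
  by (rule ext, rename_tac d, case_tac d) (simp_all add: delta_edge_Ed)

text \<open>\<open>delta_edge u v\<close> has value 1 on \<open>Ed u v\<close>, so this dart must
  lie in the support of \<open>delta_edge x y\<close>, which has only the four listed edges.\<close>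

lemma delta_edge_classes:
  assumes xy: "adj x y" and uv: "adj u v"
  shows "delta_edge u v = delta_edge x y \<or> delta_edge u v = (\<lambda>d. - delta_edge x y d)
    \<longleftrightarrow> (u, v) \<in> {(x, y), (y, x), (- x, - y), (- y, - x)}"
proof
  assume "delta_edge u v = delta_edge x y \<or> delta_edge u v = (\<lambda>d. - delta_edge x y d)"
  then have *: "delta_edge u v (Ed u v) = delta_edge x y (Ed u v)
      \<or> delta_edge u v (Ed u v) = - delta_edge x y (Ed u v)"
    by auto
  have "u \<noteq> v" "u \<noteq> - v" "u \<noteq> - u"
    using adj_neq[OF uv] vertex_neq_minus[OF adj_in(1)[OF uv]] by auto
  then have "delta_edge u v (Ed u v) = 1"
    unfolding delta_edge_Ed by simp
  with * have "delta_edge x y (Ed u v) \<noteq> 0"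
    by linarith
  moreover have "delta_edge x y (Ed u v) = 0"
    if "(u, v) \<notin> {(x, y), (y, x), (- x, - y), (- y, - x)}"
  proof -
    from that have "\<not> (u = x \<and> v = y)" "\<not> (u = y \<and> v = x)"
      "\<not> (u = - y \<and> v = - x)" "\<not> (u = - x \<and> v = - y)"
      by blast+
    then show ?thesis
      by (simp only: delta_edge_Ed of_bool_def if_False)
  qed
  ultimately show "(u, v) \<in> {(x, y), (y, x), (- x, - y), (- y, - x)}"
    by blast
next
  assume "(u, v) \<in> {(x, y), (y, x), (- x, - y), (- y, - x)}"
  then consider "u = x" "v = y" | "u = y" "v = x" | "u = - x" "v = - y" | "u = - y" "v = - x"
    by auto
  then show "delta_edge u v = delta_edge x y \<or> delta_edge u v = (\<lambda>d. - delta_edge x y d)"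
  proof cases
    case 4
    then have "delta_edge u v = (\<lambda>d. - delta_edge y x d)"
      by (simp only: delta_edge_minus)
    then show ?thesis
      by (simp add: delta_edge_flip[of y x])
  qed (simp_all only: delta_edge_minus delta_edge_flip[of y x] simp_thms)
qed

text \<open>Each class has four oriented edges as indices. In the sum over all oriented edges,
  reversal turns the \<sigma> y part into minus the sum with \<sigma> x, and that sum is twice
  \<open>u_edge E\<close>; the total is -4 times \<open>u_edge E\<close>.\<close>

lemma rho_edge_eq:
  assumes h: "Z1 h" and E: "E \<subseteq> dodeca_vertices"
    and s: "\<And>x y. adj x y \<Longrightarrow> h (Tr x y (prv x y)) + h (Tr y x (nxt y x)) = osgn E y - osgn E x"
  shows "rho_edge h = (\<lambda>d. h d - u_edge E d)"
proof
  fix d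
  define D where "D x = (\<Sum>y\<in>{y. adj x y}. delta_edge x y d)" for x
  have "int 4 * (PL ((\<lambda>p. delta_edge (fst p) (snd p)) ` oedges) h d - h d)
      = (\<Sum>p\<in>oedges. (osgn E (snd p) - osgn E (fst p)) * delta_edge (fst p) (snd p) d)"
  proof (rule PL_image[OF finite_oedges])
    fix p assume p: "p \<in> oedges"
    obtain x y where xy: "p = (x, y)" by (cases p)
    with p have a: "adj x y" by simp
    show "int4 h (delta_edge (fst p) (snd p)) = 4 * (osgn E (snd p) - osgn E (fst p))"
      using int4_delta_edge[OF h a] s[OF a] xy by simp
    have "{q \<in> oedges. delta_edge (fst q) (snd q) = delta_edge (fst p) (snd p)
          \<or> delta_edge (fst q) (snd q) = (\<lambda>d. - delta_edge (fst p) (snd p) d)}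
        = {q \<in> oedges. q \<in> {(x, y), (y, x), (- x, - y), (- y, - x)}}"
    proof (intro Collect_cong conj_cong refl)
      fix q assume q: "q \<in> oedges"
      then have "adj (fst q) (snd q)" by (cases q) simp
      from delta_edge_classes[OF a this]
      show "(delta_edge (fst q) (snd q) = delta_edge (fst p) (snd p)
          \<or> delta_edge (fst q) (snd q) = (\<lambda>d. - delta_edge (fst p) (snd p) d))
        = (q \<in> {(x, y), (y, x), (- x, - y), (- y, - x)})"
        by (simp only: xy fst_conv snd_conv prod.collapse)
    qed
    also have "\<dots> = {(x, y), (y, x), (- x, - y), (- y, - x)}"
    proof -
      have "{(x, y), (y, x), (- x, - y), (- y, - x)} \<subseteq> oedges"
        using a adj_sym[OF a] by (simp add: adj_minus)
      then show ?thesis by blast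
    qed
    finally have "{q \<in> oedges. delta_edge (fst q) (snd q) = delta_edge (fst p) (snd p)
          \<or> delta_edge (fst q) (snd q) = (\<lambda>d. - delta_edge (fst p) (snd p) d)}
        = {(x, y), (y, x), (- x, - y), (- y, - x)}" .
    moreover have "x \<noteq> y" "x \<noteq> - y" "x \<noteq> - x" "y \<noteq> - x" "y \<noteq> - y"
      using adj_neq[OF a] adj_neq[OF adj_sym[OF a]] vertex_neq_minus adj_in[OF a] by auto
    ultimately show "card {q \<in> oedges. delta_edge (fst q) (snd q) = delta_edge (fst p) (snd p)
          \<or> delta_edge (fst q) (snd q) = (\<lambda>d. - delta_edge (fst p) (snd p) d)} = 4"
      by simp
  qed
  also have "\<dots> = (\<Sum>(x, y)\<in>oedges. osgn E y * delta_edge x y d)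
      - (\<Sum>(x, y)\<in>oedges. osgn E x * delta_edge x y d)"
    by (simp add: case_prod_unfold left_diff_distrib sum_subtractf)
  also have "(\<Sum>(x, y)\<in>oedges. osgn E y * delta_edge x y d)
      = (\<Sum>(x, y)\<in>oedges. osgn E x * delta_edge y x d)"
    by (rule sum_oedges_flip)
  also have "\<dots> = - (\<Sum>(x, y)\<in>oedges. osgn E x * delta_edge x y d)"
    unfolding sum_negf[symmetric] case_prod_unfold
    by (rule sum.cong[OF refl], subst delta_edge_flip) simp
  also have "(\<Sum>(x, y)\<in>oedges. osgn E x * delta_edge x y d) = (\<Sum>x\<in>dodeca_vertices. osgn E x * D x)"
    by (simp add: sum_oedges D_def sum_distrib_left)
  also have "\<dots> = 2 * u_edge E d"
    unfolding u_edge_def D_def[symmetric]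
    by (rule osgn_vertices_sum[OF E])
      (simp only: D_def sum_nbrs_minus fun_cong[OF delta_edge_minus] sum_negf)
  finally show "rho_edge h d = h d - u_edge E d"
    by (simp add: rho_edge_def Delta_edge_def)
qed

subsection \<open>Boundaries of faces\<close>

text \<open>One of the five pieces of a decagonal face boundary: an edge cell and the truncation
  cell that follows it.\<close>

definition face_cell :: "(real^3) \<times> (real^3) \<Rightarrow> dart \<Rightarrow> int" where
  "face_cell p d = cell (Ed (fst p) (snd p)) d + cell (Tr (snd p) (fst p) (nxt (snd p) (fst p))) d"

lemma face_chain_eq: "face_chain (fst p) (snd p) d = (\<Sum>k<5. face_cell ((face_step ^^ k) p) d)"
  by (simp add: face_chain_def fwalk_eq face_cell_def case_prod_unfold)

lemma face_step_funpow: "p \<in> oedges \<Longrightarrow> (face_step ^^ k) p \<in> oedges"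
  by (induction k) (simp_all add: face_step_oedges)

lemma chain1_face_cell:
  assumes "p \<in> oedges"
  shows "chain1 (face_cell p)"
proof -
  obtain x y where p: "p = (x, y)" by (cases p)
  with assms have "adj x y" by simp
  then show ?thesis
    unfolding face_cell_def p
    by (intro chain1_add chain1_cell) (use nxt_facts(1,2) adj_sym in \<open>fastforce+\<close>)
qed

text \<open>\<open>face_step ^^ (5 - k)\<close> inverts \<open>face_step ^^ k\<close> on
  \<open>oedges\<close>. The sum gathers the coefficients of the five starting edges of one decagon,
  which makes it a function on faces.\<close>

definition face_coeff :: "((real^3) \<times> (real^3) \<Rightarrow> int) \<Rightarrow> (real^3) \<times> (real^3) \<Rightarrow> int" where
  "face_coeff c p = (\<Sum>k<5. c ((face_step ^^ (5 - k)) p))"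

lemma face_sum_eq:
  "(\<Sum>p\<in>oedges. c p * face_chain (fst p) (snd p) d) = (\<Sum>p\<in>oedges. face_coeff c p * face_cell p d)"
proof -
  have "(\<Sum>p\<in>oedges. c p * face_chain (fst p) (snd p) d)
      = (\<Sum>k<5. \<Sum>p\<in>oedges. c p * face_cell ((face_step ^^ k) p) d)"
    unfolding face_chain_eq sum_distrib_left by (rule sum.swap)
  also have "\<dots> = (\<Sum>k<5. \<Sum>p\<in>oedges. c ((face_step ^^ (5 - k)) p) * face_cell p d)"
  proof (rule sum.cong[OF refl])
    fix k :: nat assume "k \<in> {..<5}"
    then have inv: "(face_step ^^ (5 - k)) ((face_step ^^ k) p) = p"
      "(face_step ^^ k) ((face_step ^^ (5 - k)) p) = p" if "p \<in> oedges" for p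
      using face_step_5[OF that] by (simp_all add: funpow_add[symmetric, THEN fun_cong, unfolded o_def])
    show "(\<Sum>p\<in>oedges. c p * face_cell ((face_step ^^ k) p) d)
        = (\<Sum>p\<in>oedges. c ((face_step ^^ (5 - k)) p) * face_cell p d)"
      by (rule sum.reindex_bij_witness[of _ "face_step ^^ (5 - k)" "face_step ^^ k"])
        (simp_all add: inv face_step_funpow)
  qed
  also have "\<dots> = (\<Sum>p\<in>oedges. face_coeff c p * face_cell p d)"
    unfolding face_coeff_def sum_distrib_right by (rule sum.swap)
  finally show ?thesis .
qed

lemma face_coeff_step:
  assumes "p \<in> oedges"
  shows "face_coeff c (face_step p) = face_coeff c p"
  using face_step_5[OF assms] by (simp add: face_coeff_def eval_nat_numeral)

lemma face_coeff_invariant: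
  assumes "\<And>p. p \<in> oedges \<Longrightarrow> c (face_step p) = c p" "p \<in> oedges"
  shows "face_coeff c p = 5 * c p"
proof -
  have "c ((face_step ^^ k) p) = c p" for k
    by (induction k) (simp_all add: assms face_step_funpow)
  then show ?thesis by (simp add: face_coeff_def)
qed

text \<open>The faces on the two sides of an edge run along it in opposite directions. A truncation
  cell lies on one face at \<open>x\<close> and, through the identification, on one face at
  \<open>- x\<close>, which meets it with the opposite sign.\<close>

lemma face_sum_values:
  assumes C: "\<And>p. p \<in> oedges \<Longrightarrow> C (face_step p) = C p" and xy: "adj x y"
  shows "(\<Sum>p\<in>oedges. C p * face_cell p (Ed x y)) = C (x, y) - C (y, x)"
    and "(\<Sum>p\<in>oedges. C p * face_cell p (Tr x y (nxt x y))) = C (y, x) - C (- x, - y)"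
proof -
  have pick: "(\<Sum>p\<in>oedges. C p * of_bool (p = q)) = C q" if "q \<in> oedges" for q
    using that by (simp add: of_bool_def if_distrib[of "\<lambda>c. _ * c"] cong: if_cong)
  have yx: "adj y x" using xy by (rule adj_sym)
  have "(\<Sum>p\<in>oedges. C p * face_cell p (Ed x y))
      = (\<Sum>p\<in>oedges. C p * of_bool (p = (x, y)) - C p * of_bool (p = (y, x)))"
    by (intro sum.cong refl)
      (simp add: face_cell_def cell_Ed_Ed prod_eq_iff eq_commute[of x] eq_commute[of y] conj_commute right_diff_distrib)
  then show "(\<Sum>p\<in>oedges. C p * face_cell p (Ed x y)) = C (x, y) - C (y, x)"
    using pick[of "(x, y)"] pick[of "(y, x)"] xy yx by (simp add: sum_subtractf)
  have n: "adj (- nxt x y) (- x)"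
    using nxt_facts(1)[OF xy] adj_sym by (simp add: adj_minus)
  have "nxt (- x) (- nxt x y) = - y"
    using nxt_facts(7)[OF nxt_facts(1)[OF xy]] prv_nxt[OF xy] by simp
  \<comment> \<open>The face at \<open>- x\<close> is entered along \<open>(- nxt x y, - x)\<close>,
    and its next edge is \<open>(- x, - y)\<close>.\<close>
  then have step: "C (- nxt x y, - x) = C (- x, - y)"
    using C[of "(- nxt x y, - x)"] n by (simp add: face_step_def)
  have "(\<Sum>p\<in>oedges. C p * face_cell p (Tr x y (nxt x y)))
      = (\<Sum>p\<in>oedges. C p * of_bool (p = (y, x)) - C p * of_bool (p = (- nxt x y, - x)))"
  proof (intro sum.cong refl, clarify)
    fix u v assume "(u, v) \<in> oedges"
    then have "adj v u" by (simp add: adj_sym)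
    then show "C (u, v) * face_cell (u, v) (Tr x y (nxt x y))
        = C (u, v) * of_bool ((u, v) = (y, x)) - C (u, v) * of_bool ((u, v) = (- nxt x y, - x))"
      using cell_Tr_Tr[of v u x y] xy
      by (simp add: face_cell_def right_diff_distrib conj_commute)
  qed
  then show "(\<Sum>p\<in>oedges. C p * face_cell p (Tr x y (nxt x y))) = C (y, x) - C (- x, - y)"
    using pick[of "(y, x)"] pick[of "(- nxt x y, - x)"] n yx step by (simp add: sum_subtractf)
qed

lemma chain1_face_sum: "chain1 (\<lambda>d. \<Sum>p\<in>oedges. C p * face_cell p d)"
  by (intro chain1_sum chain1_mult chain1_face_cell)

lemma face_sum_nxt:
  assumes C: "\<And>p. p \<in> oedges \<Longrightarrow> C (face_step p) = C p" and xy: "adj x y"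
  shows "C (y, x) = C (x, nxt x y)" and "C (prv x y, x) = C (x, y)"
    and "C (- x, - prv x y) = C (- y, - x)"
proof -
  show "C (y, x) = C (x, nxt x y)"
    using C[of "(y, x)"] adj_sym[OF xy] by (simp add: face_step_def)
  show "C (prv x y, x) = C (x, y)"
    using C[of "(prv x y, x)"] adj_sym[OF adj_prv[OF xy]] nxt_facts(6)[OF xy]
    by (simp add: face_step_def)
  show "C (- x, - prv x y) = C (- y, - x)"
    using C[of "(- y, - x)"] adj_sym[OF xy] nxt_facts(7)[OF xy] by (simp add: face_step_def adj_minus)
qed

text \<open>The four faces around a 0-cell each occur in the balance once with either sign.\<close>

lemma Z1_face_sum:
  assumes C: "\<And>p. p \<in> oedges \<Longrightarrow> C (face_step p) = C p"
  shows "Z1 (\<lambda>d. \<Sum>p\<in>oedges. C p * face_cell p d)" (is "Z1 ?F")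
  unfolding Z1_iff_flow
proof (intro conjI allI impI)
  fix x y assume xy: "adj x y"
  note v = face_sum_values[where C=C, OF C]
  have "?F (Tr x y (prv x y)) = - ?F (Tr x (prv x y) (nxt x (prv x y)))"
    by (rule chain1_Tr_prv[OF chain1_face_sum xy])
  also have "\<dots> = C (- y, - x) - C (x, y)"
    using v(2)[OF _ adj_prv[OF xy]] face_sum_nxt(2,3)[where C=C, OF C xy] by simp
  finally show "flow ?F x y = 0"
    using xy by (simp add: flow_def v adj_minus)
qed (rule chain1_face_sum)

lemma Z1_cancel:
  assumes "c \<noteq> 0" "Z1 (\<lambda>d. c * f d)"
  shows "Z1 f"
proof -
  have "chain1 f"
    using assms by (simp add: Z1_def chain1_def flip: mult_minus_right)
  moreover have "flow (\<lambda>d. c * f d) x y = c * flow f x y" for x y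
    by (simp only: flow_def distrib_left)
  ultimately show ?thesis
    using assms by (simp add: Z1_iff_flow)
qed

text \<open>Turns a homology into an integer function on faces whose jumps can be read off cell by
  cell.\<close>

lemma homologous_coeff:
  assumes "homologous f g"
  obtains C where "\<And>p. p \<in> oedges \<Longrightarrow> C (face_step p) = C p"
    and "\<And>x y. adj x y \<Longrightarrow> f (Ed x y) = g (Ed x y) + C (x, y) - C (y, x)"
    and "\<And>x y. adj x y \<Longrightarrow> f (Tr x y (nxt x y)) = g (Tr x y (nxt x y)) + C (y, x) - C (- x, - y)"
proof -
  obtain c where c: "f d - g d = (\<Sum>p\<in>oedges. c p * face_chain (fst p) (snd p) d)" for d
    using assms unfolding homologous_def by blast
  note c' = c[unfolded face_sum_eq]
  show thesis
  proof (rule that[of "face_coeff c"])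
    fix x y assume xy: "adj x y"
    show "f (Ed x y) = g (Ed x y) + face_coeff c (x, y) - face_coeff c (y, x)"
      using c'[of "Ed x y"] face_sum_values(1)[where C="face_coeff c", OF face_coeff_step xy] by simp
    show "f (Tr x y (nxt x y)) = g (Tr x y (nxt x y)) + face_coeff c (y, x) - face_coeff c (- x, - y)"
      using c'[of "Tr x y (nxt x y)"] face_sum_values(2)[where C="face_coeff c", OF face_coeff_step xy] by simp
  qed (rule face_coeff_step)
qed

subsection \<open>Tetrahedra in inscribed cubes\<close>

text \<open>The Gram matrix is \<open>r - c\<close> times the identity plus \<open>c\<close> times
  the all-ones matrix. Its eigenvalues \<open>r - c\<close> and \<open>r + (card S - 1) * c\<close>
  are nonzero, so the points are linearly independent.\<close>

lemma card_equiangular_le: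
  fixes S :: "'a :: euclidean_space set"
  assumes "finite S" and self: "\<And>p. p \<in> S \<Longrightarrow> p \<bullet> p = r"
    and ip: "\<And>p q. p \<in> S \<Longrightarrow> q \<in> S \<Longrightarrow> p \<noteq> q \<Longrightarrow> p \<bullet> q = c"
    and c: "c \<noteq> r" "r + (real (card S) - 1) * c \<noteq> 0"
  shows "card S \<le> DIM('a)"
proof -
  have "independent S"
  proof (rule independent_if_scalars_zero[OF assms(1)])
    fix f :: "'a \<Rightarrow> real" and q assume f: "(\<Sum>p\<in>S. f p *\<^sub>R p) = 0" and q: "q \<in> S"
    define s where "s = (\<Sum>p\<in>S. f p)"
    have eq: "(r - c) * f p = - c * s" if p: "p \<in> S" for p
    proof -
      have "0 = (\<Sum>u\<in>S. f u *\<^sub>R u) \<bullet> p" using f by simp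
      also have "\<dots> = (\<Sum>u\<in>S. f u * (u \<bullet> p))" by (simp add: inner_sum_left)
      also have "\<dots> = (\<Sum>u\<in>S. f u * c + (if u = p then f u * (r - c) else 0))"
        using p by (intro sum.cong) (auto simp: self ip algebra_simps)
      also have "\<dots> = s * c + f p * (r - c)"
        using p assms(1) by (simp add: sum.distrib s_def sum_distrib_right)
      finally show ?thesis by (simp add: algebra_simps)
    qed
    \<comment> \<open>Adding the equations over \<open>S\<close> leaves a nonzero multiple of the
      coefficient sum \<open>s\<close>.\<close>
    have "(r - c) * s = (\<Sum>p\<in>S. - c * s)"
      unfolding s_def sum_distrib_left[of "r - c"] using eq by (intro sum.cong) (auto simp: s_def)
    then have "(r + (real (card S) - 1) * c) * s = 0"
      by (simp add: algebra_simps)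
    then have "s = 0" using c by simp
    then show "f q = 0" using eq[OF q] c by simp
  qed
  then show ?thesis by (simp add: independent_card_le)
qed

text \<open>The quotient of the larger by the smaller value must be 2, 3 or 3/2. Among the listed
  numbers this happens only for two of 4, 8 and 12.\<close>

lemma distance_ratio:
  fixes b D1 D2 :: real
  assumes "D1 \<in> {4, 8, 12, 6 - 2 * sqrt 5, 6 + 2 * sqrt 5}"
    and "D2 \<in> {4, 8, 12, 6 - 2 * sqrt 5, 6 + 2 * sqrt 5}"
    and "D1 \<in> {b, 2 * b, 3 * b}" "D2 \<in> {b, 2 * b, 3 * b}" "D1 \<noteq> D2"
  shows "b = 4"
proof -
  \<comment> \<open>Bounds this close keep quotients such as \<open>(6 + 2 * sqrt 5) / 4\<close>
    away from 2 and 3.\<close>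
  have "22 / 10 < sqrt (5 :: real)" "sqrt (5 :: real) < 23 / 10"
    by (rule real_less_rsqrt real_less_lsqrt; simp add: power2_eq_square)+
  then show ?thesis
    using assms unfolding insert_iff empty_iff by (elim disjE FalseE) linarith+
qed

lemma antipode_dist:
  assumes "p \<in> dodeca_vertices" "q \<in> dodeca_vertices" "r \<in> dodeca_vertices"
    and "p \<bullet> q = - 3"
  shows "p \<bullet> r = - (q \<bullet> r)"
  using vertex_inner_eq_minus_3[OF assms(1,2,4)] by simp

text \<open>The five distances between distinct vertices have squares
  \<open>4\<close>, \<open>8\<close>, \<open>12\<close> and \<open>6 \<plusminus> 2 \<surd>5\<close>. Eight points of a three-dimensional space are
  never equidistant, so two distances in the ratio of a cube's occur, which
  leaves only the cubes of edge \<open>2\<close>.\<close>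

lemma cube_inner:
  assumes "e \<in> cubes"
  shows "\<And>p q. p \<in> e \<Longrightarrow> q \<in> e \<Longrightarrow> p \<noteq> q \<Longrightarrow> p \<bullet> q \<in> {1, -1, -3}"
    and "min_dist e = 2"
proof -
  obtain a where e: "e \<subseteq> dodeca_vertices" "card e = 8" and a: "a > 0"
    and dist: "\<And>p q. p \<in> e \<Longrightarrow> q \<in> e \<Longrightarrow> p \<noteq> q \<Longrightarrow> dist p q \<in> {a, sqrt 2 * a, sqrt 3 * a}"
    using assms unfolding cubes_def inscribed_cube_def by auto
  have fin: "finite e" using e(1) finite_vertices by (rule finite_subset)
  define D where "D p q = 6 - 2 * (p \<bullet> q)" for p q :: "real^3"
  have D: "D p q \<in> {4, 8, 12, 6 - 2 * sqrt 5, 6 + 2 * sqrt 5}"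
    "D p q \<in> {a\<^sup>2, 2 * a\<^sup>2, 3 * a\<^sup>2}" "(dist p q)\<^sup>2 = D p q"
    if "p \<in> e" "q \<in> e" "p \<noteq> q" for p q
  proof -
    have pq: "p \<in> dodeca_vertices" "q \<in> dodeca_vertices" using that e by auto
    show d: "(dist p q)\<^sup>2 = D p q" unfolding D_def by (rule dist_vertices[OF pq])
    show "D p q \<in> {4, 8, 12, 6 - 2 * sqrt 5, 6 + 2 * sqrt 5}"
      using vertex_inner_cases[OF pq] vertex_inner_eq_3[OF pq] that unfolding D_def by auto
    show "D p q \<in> {a\<^sup>2, 2 * a\<^sup>2, 3 * a\<^sup>2}"
      using dist[OF that] unfolding d[symmetric] by (auto simp: power_mult_distrib)
  qed
  have "\<exists>p\<in>e. \<exists>q\<in>e. \<exists>r\<in>e. \<exists>s\<in>e. p \<noteq> q \<and> r \<noteq> s \<and> D p q \<noteq> D r s"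
  proof (rule ccontr)
    assume neg: "\<not> ?thesis"
    obtain p q where pq: "p \<in> e" "q \<in> e" "p \<noteq> q"
      using e(2) by (metis card_le_Suc0_iff_eq fin numeral_le_one_iff One_nat_def semiring_norm(69))
    define c where "c = p \<bullet> q"
    have "c \<in> {1, -1, -3, sqrt 5, - sqrt 5}"
      using D(1)[OF pq] unfolding D_def c_def by auto
    then have "c \<noteq> 3" "3 + (real (card e) - 1) * c \<noteq> 0"
      using sqrt5_bounds e(2) by auto
    moreover have "r \<bullet> s = c" if "r \<in> e" "s \<in> e" "r \<noteq> s" for r s
    proof -
      have "D p q = D r s" using neg pq that by blast
      then show ?thesis by (simp add: D_def c_def)
    qed
    moreover have "r \<bullet> r = 3" if "r \<in> e" for r
      using vertex_inner_self that e by auto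
    ultimately have "card e \<le> DIM(real^3)"
      by (intro card_equiangular_le[OF fin, of 3 c])
    then show False using e(2) by simp
  qed
  then obtain p q r s where pqrs: "p \<in> e" "q \<in> e" "r \<in> e" "s \<in> e" "p \<noteq> q" "r \<noteq> s" "D p q \<noteq> D r s"
    by blast
  have a2: "a\<^sup>2 = 4"
    using distance_ratio[OF D(1)[OF pqrs(1,2,5)] D(1)[OF pqrs(3,4,6)] D(2)[OF pqrs(1,2,5)]
        D(2)[OF pqrs(3,4,6)] pqrs(7)] .
  have D3: "D p q \<in> {4, 8, 12}" if "p \<in> e" "q \<in> e" "p \<noteq> q" for p q
    using D(2)[OF that] a2 by auto
  show ip: "p \<bullet> q \<in> {1, -1, -3}" if "p \<in> e" "q \<in> e" "p \<noteq> q" for p q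
    using D3[OF that] unfolding D_def by auto
  have "\<exists>p\<in>e. \<exists>q\<in>e. p \<noteq> q \<and> D p q = 4"
  proof (rule ccontr)
    assume neg: "\<not> ?thesis"
    then have D2: "D p q = 8 \<or> D p q = 12" if "p \<in> e" "q \<in> e" "p \<noteq> q" for p q
      using D3[OF that] that by blast
    then obtain p q where pq: "p \<in> e" "q \<in> e" "p \<noteq> q" "D p q = 12"
      using pqrs by metis
    have "\<not> e \<subseteq> {p, q}"
    proof
      assume "e \<subseteq> {p, q}"
      then have "card e \<le> card {p, q}" by (intro card_mono) auto
      also have "\<dots> \<le> 2" by (simp add: card_insert_if)
      finally show False using e(2) by simp
    qed
    then obtain r where r: "r \<in> e" "r \<noteq> p" "r \<noteq> q" by auto
    \<comment> \<open>\<open>p\<close> and \<open>q\<close> are antipodal, so their inner products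
      with \<open>r\<close> are opposite; but squared distances 8 and 12 make both negative.\<close>
    have "p \<bullet> r = - (q \<bullet> r)"
      using pq r e by (intro antipode_dist) (auto simp: D_def)
    then show False
      using D2[of p r] D2[of q r] pq r unfolding D_def by auto
  qed
  then obtain p q where pq: "p \<in> e" "q \<in> e" "p \<noteq> q" "D p q = 4" by blast
  show "min_dist e = 2"
    unfolding min_dist_def
  proof (rule Min_eqI)
    have "{dist p q |p q. p \<in> e \<and> q \<in> e \<and> p \<noteq> q} \<subseteq> (\<lambda>(p, q). dist p q) ` (e \<times> e)"
      by auto
    then show "finite {dist p q |p q. p \<in> e \<and> q \<in> e \<and> p \<noteq> q}"
      by (rule finite_subset) (simp add: fin)
  next
    fix d assume "d \<in> {dist p q |p q. p \<in> e \<and> q \<in> e \<and> p \<noteq> q}"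
    then obtain p q where d: "d = dist p q" "p \<in> e" "q \<in> e" "p \<noteq> q" by auto
    then have "2\<^sup>2 \<le> d\<^sup>2" using D3[of p q] D(3)[of p q] by auto
    then show "2 \<le> d" using d by (meson power2_le_imp_le zero_le_dist)
  next
    have "(dist p q)\<^sup>2 = 2\<^sup>2" using D(3)[OF pq(1-3)] pq(4) by simp
    then have "dist p q = 2" by (metis power2_eq_imp_eq zero_le_dist zero_le_numeral)
    then show "2 \<in> {dist p q |p q. p \<in> e \<and> q \<in> e \<and> p \<noteq> q}"
      using pq unfolding mem_Collect_eq by metis
  qed
qed

text \<open>Non-adjacent cube vertices have inner product -1 or -3. An antipodal pair is excluded by
  a third point of \<open>E\<close>, whose inner products with the pair would be opposite although
  both are negative.\<close>

lemma tetra_inner: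
  assumes e: "e \<in> cubes" and E: "tetra_of e E" and pq: "p \<in> E" "q \<in> E" "p \<noteq> q"
  shows "p \<bullet> q = -1"
proof -
  have sub: "E \<subseteq> e" "card E = 4" "e \<subseteq> dodeca_vertices"
    using e E by (auto simp: tetra_of_def cubes_def inscribed_cube_def)
  have ip: "u \<bullet> v = -1 \<or> u \<bullet> v = -3" if "u \<in> E" "v \<in> E" "u \<noteq> v" for u v
  proof -
    have uv: "u \<in> dodeca_vertices" "v \<in> dodeca_vertices" "u \<in> e" "v \<in> e" using that sub by auto
    have "dist u v \<noteq> 2"
      using E that cube_inner(2)[OF e] by (auto simp: tetra_of_def)
    then have "u \<bullet> v \<noteq> 1"
      using dist_vertices[OF uv(1,2)] real_sqrt_unique[of "dist u v" 4] by auto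
    then show ?thesis
      using cube_inner(1)[OF e uv(3,4) that(3)] by auto
  qed
  have "p \<bullet> q \<noteq> -3"
  proof
    assume a: "p \<bullet> q = -3"
    have "\<not> E \<subseteq> {p, q}"
    proof
      assume "E \<subseteq> {p, q}"
      then have "card E \<le> card {p, q}" by (intro card_mono) auto
      also have "\<dots> \<le> 2" by (simp add: card_insert_if)
      finally show False using sub(2) by simp
    qed
    then obtain r where r: "r \<in> E" "r \<noteq> p" "r \<noteq> q" by auto
    have "p \<bullet> r = - (q \<bullet> r)"
      using pq r sub a by (intro antipode_dist) auto
    then show False
      using ip[of p r] ip[of q r] pq r by auto
  qed
  with ip[OF pq] show ?thesis by blast
qed

text \<open>The squared length of the sum is 4 * 3 + 12 * (-1) = 0.\<close>

lemma tetra_sum: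
  assumes e: "e \<in> cubes" and E: "tetra_of e E"
  shows "\<Sum>E = 0"
proof -
  have sub: "E \<subseteq> dodeca_vertices" "card E = 4"
    using e E by (auto simp: tetra_of_def cubes_def inscribed_cube_def)
  have fin: "finite E" using sub(1) finite_vertices by (rule finite_subset)
  have "\<Sum>E \<bullet> \<Sum>E = (\<Sum>p\<in>E. \<Sum>q\<in>E. p \<bullet> q)"
    unfolding inner_sum_left inner_sum_right by (rule sum.swap)
  also have "\<dots> = (\<Sum>p\<in>E. \<Sum>q\<in>E. (if q = p then 4 else 0) - 1)"
    using sub tetra_inner[OF e E] vertex_inner_self by (intro sum.cong refl) auto
  also have "\<dots> = 0"
    using fin sub(2) by (simp add: sum_subtractf)
  finally show ?thesis by simp
qed

text \<open>For nonzero \<open>n\<close> the exponent of 5 is odd in \<open>5 * n\<^sup>2\<close>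
  and even in \<open>m\<^sup>2\<close>.\<close>

lemma sqrt5_independent:
  fixes m n :: int
  assumes "of_int m + of_int n * sqrt 5 = 0"
  shows "n = 0"
proof (rule ccontr)
  assume n: "n \<noteq> 0"
  have "of_int n * sqrt 5 = of_int (- m)"
    using assms by simp
  then have "(of_int n * sqrt 5)\<^sup>2 = (of_int (- m))\<^sup>2"
    by simp
  then have "real_of_int (5 * n\<^sup>2) = real_of_int (m\<^sup>2)"
    by (simp add: power_mult_distrib)
  then have eq: "5 * n\<^sup>2 = m\<^sup>2"
    by linarith
  then have m: "m \<noteq> 0" using n by auto
  have p: "prime_elem (5 :: int)" by (rule prime_imp_prime_elem) simp
  have "multiplicity 5 (5 * n\<^sup>2) = Suc (2 * multiplicity 5 n)"
    using n p by (simp add: prime_elem_multiplicity_mult_distrib prime_elem_multiplicity_power_distrib)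
  moreover have "multiplicity 5 (m\<^sup>2) = 2 * multiplicity 5 m"
    using m p by (simp add: prime_elem_multiplicity_power_distrib)
  ultimately have "Suc (2 * multiplicity 5 n) = 2 * multiplicity 5 m"
    by (simp add: eq)
  then show False by presburger
qed

text \<open>Pairing \<open>\<Sum>E = 0\<close> with \<open>x\<close>, the coefficient of \<open>\<surd>5\<close> counts the
  neighbours of \<open>x\<close> in \<open>E\<close> minus those in \<open>- E\<close>.\<close>

lemma tetra_nbrs_sum:
  assumes e: "e \<in> cubes" and E: "tetra_of e E" and x: "x \<in> dodeca_vertices"
  shows "(\<Sum>y\<in>{y. adj x y}. osgn E y) = 0"
proof -
  have sub: "E \<subseteq> dodeca_vertices"
    using e E by (auto simp: tetra_of_def cubes_def inscribed_cube_def)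
  have fin: "finite E" using sub(1) finite_vertices by (rule finite_subset)
  define n where "n y = (of_bool (adj x y) - of_bool (adj x (- y)) :: int)" for y
  have "\<exists>m :: int. x \<bullet> y = of_int m + of_int (n y) * sqrt 5" if "y \<in> E" for y
  proof -
    have y: "y \<in> dodeca_vertices" using that sub by auto
    have n: "n y = of_bool (x \<bullet> y = sqrt 5) - of_bool (x \<bullet> y = - sqrt 5)"
      using x y by (auto simp: n_def adj_iff_inner simp del: of_bool_eq_iff)
    have s: "sqrt 5 \<noteq> - sqrt (5 :: real)" using sqrt5_bounds by linarith
    from vertex_inner_cases[OF x y]
    consider "x \<bullet> y = sqrt 5" | "x \<bullet> y = - sqrt 5" | "x \<bullet> y \<in> {1, -1, 3, -3}" by auto
    then show ?thesis
    proof cases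
      case 1
      with s have "n y = 1" unfolding n by simp
      with 1 show ?thesis by (intro exI[of _ 0]) simp
    next
      case 2
      with s have "n y = -1" unfolding n by simp
      with 2 show ?thesis by (intro exI[of _ 0]) simp
    next
      case 3
      then have "n y = 0" unfolding n using sqrt5_bounds by auto
      with 3 show ?thesis
        by (auto intro: exI[of _ 1] exI[of _ "-1"] exI[of _ 3] exI[of _ "-3"])
    qed
  qed
  then obtain m :: "real^3 \<Rightarrow> int" where m: "\<And>y. y \<in> E \<Longrightarrow> x \<bullet> y = of_int (m y) + of_int (n y) * sqrt 5"
    by metis
  have "0 = x \<bullet> \<Sum>E" by (simp add: tetra_sum[OF e E])
  also have "\<dots> = (\<Sum>y\<in>E. of_int (m y) + of_int (n y) * sqrt 5)"
    by (simp add: inner_sum_right m)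
  also have "\<dots> = of_int (\<Sum>y\<in>E. m y) + of_int (\<Sum>y\<in>E. n y) * sqrt 5"
    by (simp add: sum.distrib sum_distrib_right)
  finally have "(\<Sum>y\<in>E. n y) = 0"
    by (metis sqrt5_independent)
  moreover have "(\<Sum>y\<in>{y. adj x y}. osgn E y) = (\<Sum>y\<in>E. n y)"
  proof -
    have "(\<Sum>y\<in>{y. adj x y}. of_bool (y \<in> E) :: int) = (\<Sum>y\<in>E. of_bool (adj x y))"
      using fin by (simp add: of_bool_def sum.If_cases Int_commute Collect_conj_eq)
    moreover have "(\<Sum>y\<in>{y. adj x y}. of_bool (- y \<in> E) :: int) = (\<Sum>y\<in>{y. adj x (- y)}. of_bool (y \<in> E))"
      by (rule sum.reindex_bij_witness[of _ uminus uminus]) auto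
    moreover have "finite {y. adj x (- y)}"
      using finite_nbrs[of "- x"] by (simp add: adj_minus_left)
    then have "(\<Sum>y\<in>{y. adj x (- y)}. of_bool (y \<in> E) :: int) = (\<Sum>y\<in>E. of_bool (adj x (- y)))"
      using fin by (simp add: of_bool_def sum.If_cases Int_commute Collect_conj_eq)
    ultimately show ?thesis
      by (simp add: osgn_def n_def sum_subtractf)
  qed
  ultimately show ?thesis by simp
qed

subsection \<open>Dividing the edge class by three\<close>

text \<open>\<open>vertex_weights\<close> expresses a solution of the neighbour equations by its values at the
  vertices \<open>0, 1, 2, 3\<close>. \<open>face_table\<close> lists the boundary cycle of each face with the
  coefficients of the potential modulo \<open>3\<close>, found by summing vertex differences across edges
  outwards from the first face.\<close>

definition vertex_weights :: "int list list" where
  "vertex_weights =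
    [[1, 0, 0, 0], [0, 1, 0, 0], [0, 0, 1, 0], [0, 0, 0, 1], [0, 1, -1, 0],
     [0, 0, 1, 1], [0, -1, 0, -1], [1, 0, 0, -1], [1, 1, 0, 0], [-1, 0, -1, 0],
     [1, 0, 1, 0], [-1, -1, 0, 0], [-1, 0, 0, 1], [0, 1, 0, 1], [0, 0, -1, -1],
     [0, -1, 1, 0], [0, 0, 0, -1], [0, 0, -1, 0], [0, -1, 0, 0], [-1, 0, 0, 0]]"

definition face_table :: "(nat list \<times> int list) list" where
  "face_table =
    [([0, 4, 16, 11, 5], [0, 0, 0, 0]), ([3, 15, 19, 14, 8], [0, 0, 0, 0]),
     ([0, 6, 2, 12, 4], [1, -1, 1, 0]), ([7, 17, 13, 19, 15], [1, -1, 1, 0]),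
     ([0, 5, 1, 9, 6], [-1, 0, 1, 1]), ([10, 18, 14, 19, 13], [-1, 0, 1, 1]),
     ([1, 5, 11, 17, 7], [-1, -1, -1, -1]), ([2, 8, 14, 18, 12], [-1, -1, -1, -1]),
     ([1, 7, 15, 3, 9], [0, 1, -1, 1]), ([4, 12, 18, 10, 16], [0, 1, -1, 1]),
     ([2, 6, 9, 3, 8], [1, 1, 0, -1]), ([10, 13, 17, 11, 16], [1, 1, 0, -1])]"

text \<open>\<open>zip f (rotate1 f)\<close> lists the oriented edges of a face, so the lookup finds
  the entry of the face to the left of the edge.\<close>

definition face_weights :: "nat \<times> nat \<Rightarrow> int list" where
  "face_weights p = the (map_of (concat (map (\<lambda>(f, w). map (\<lambda>q. (q, w)) (zip f (rotate1 f))) face_table)) p)"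

definition combine :: "(nat \<Rightarrow> int) \<Rightarrow> int list \<Rightarrow> int" where
  "combine t w = w ! 0 * t 0 + w ! 1 * t 1 + w ! 2 * t 2 + w ! 3 * t 3"

text \<open>The potential has to be constant along each face, equal on antipodal faces, and correct
  modulo 3 across edges. The congruence is imposed on each of the four coefficients, so that it
  holds for all values at the vertices 0 to 3.\<close>

fun weights_ok :: "nat \<times> nat \<Rightarrow> bool" where
  "weights_ok (i, j) \<longleftrightarrow> face_weights (walk (i, j)) = face_weights (i, j) \<and>
     face_weights (19 - i, 19 - j) = face_weights (j, i) \<and>
     (\<forall>k\<in>{0, 1, 2, 3}. 3 dvd vertex_weights ! i ! k - vertex_weights ! j ! k
        + face_weights (i, j) ! k - face_weights (j, i) ! k)"

lemma weights_ok_all: "list_all weights_ok oedge_list"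
  by code_simp

lemma oedge_list_iff: "(i, j) \<in> set oedge_list \<longleftrightarrow> i < 20 \<and> j \<in> set (nbrs ! i)"
  by (auto simp: oedge_list_def)

text \<open>Oddness leaves ten unknowns, and the neighbour equations at the vertices 0 to 9 express
  all of them through the first four.\<close>

lemma osgn_vtx:
  assumes sum: "\<And>x. x \<in> dodeca_vertices \<Longrightarrow> (\<Sum>y\<in>{y. adj x y}. osgn E y) = 0"
    and i: "i < 20"
  shows "osgn E (vtx i) = combine (\<lambda>k. osgn E (vtx k)) (vertex_weights ! i)"
proof -
  define s where "s k = osgn E (vtx k)" for k
  have rel: "s j + (s (nx k j) + s (nx k (nx k j))) = 0" if "k < 20" "j \<in> set (nbrs ! k)" for k j
  proof -
    note nx = nx_facts[OF that]
    have "j < 20" using that by (rule nbrs_less)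
    then have "adj (vtx k) (vtx j)" using that by (simp add: adj_vtx)
    from sum_nbrs[OF this, of "osgn E"] show ?thesis
      using sum[OF vtx_in[OF that(1)]] that nx by (simp add: s_def prv_def nxt_vtx)
  qed
  have minus: "s (19 - k) = - s k" if "k < 20" for k
    using that by (simp add: s_def vtx_minus osgn_minus)
  have neg: "s 19 = - s 0" "s 18 = - s 1" "s 17 = - s 2" "s 16 = - s 3" "s 15 = - s 4"
    "s 14 = - s 5" "s 13 = - s 6" "s 12 = - s 7" "s 11 = - s 8" "s 10 = - s 9"
    using minus[of 0] minus[of 1] minus[of 2] minus[of 3] minus[of 4]
      minus[of 5] minus[of 6] minus[of 7] minus[of 8] minus[of 9] by simp_all
  have nbr: "s 4 + (s 6 + s 5) = 0" "s 5 + (s 9 + s 7) = 0" "s 6 + (s 12 + s 8) = 0"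
    "s 8 + (s 15 + s 9) = 0" "s 0 + (s 16 + s 12) = 0" "s 0 + (s 1 + s 11) = 0"
    "s 0 + (s 2 + s 9) = 0" "s 1 + (s 15 + s 17) = 0" "s 2 + (s 14 + s 3) = 0"
    "s 1 + (s 6 + s 3) = 0"
    using rel[of 0 4] rel[of 1 5] rel[of 2 6] rel[of 3 8] rel[of 4 0] rel[of 5 0]
      rel[of 6 0] rel[of 7 1] rel[of 8 2] rel[of 9 1]
    by (simp_all add: nbrs_def nx_def)
  have "i \<in> {0, 1, 2, 3, 4, 5, 6, 7, 8, 9, 10, 11, 12, 13, 14, 15, 16, 17, 18, 19}"
    using i unfolding insert_iff empty_iff by presburger
  then have "s i = combine s (vertex_weights ! i)"
    unfolding insert_iff empty_iff
    by (elim disjE FalseE; simp add: combine_def vertex_weights_def del: One_nat_def)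
      (use neg nbr in linarith)+
  then show ?thesis by (simp add: s_def[abs_def])
qed

text \<open>Around \<open>x\<close> the differences \<sigma> x - \<sigma> y add up to 3 \<sigma> x,
  hence to 0 modulo 3; on a sphere this is what makes them differences of a function on the faces.
  The function itself is taken from the table.\<close>

lemma exists_face_potential:
  assumes sum: "\<And>x. x \<in> dodeca_vertices \<Longrightarrow> (\<Sum>y\<in>{y. adj x y}. osgn E y) = 0"
  obtains C where "\<And>p. p \<in> oedges \<Longrightarrow> C (face_step p) = C p"
    and "\<And>x y. adj x y \<Longrightarrow> C (- x, - y) = C (y, x)"
    and "\<And>x y. adj x y \<Longrightarrow> 3 dvd osgn E x - osgn E y + C (x, y) - C (y, x)"
proof -
  define t where "t k = osgn E (vtx k)" for k
  \<comment> \<open>Inverts \<open>vtx\<close>, so that the table can be evaluated at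
    points.\<close>
  define idx where "idx x = (THE i. i < 20 \<and> vtx i = x)" for x
  have idx: "idx (vtx i) = i" if "i < 20" for i
    unfolding idx_def using that vtx_inject by blast
  define C where "C p = combine t (face_weights (idx (fst p), idx (snd p)))" for p
  have C: "C (vtx i, vtx j) = combine t (face_weights (i, j))" if "i < 20" "j < 20" for i j
    using that by (simp add: C_def idx)
  have ok: "weights_ok (i, j)" if "i < 20" "j \<in> set (nbrs ! i)" for i j
    using weights_ok_all that by (simp add: list_all_iff oedge_list_iff del: weights_ok.simps)
  show thesis
  proof
    fix p assume "p \<in> oedges"
    then obtain x y where xy: "p = (x, y)" "adj x y" by (cases p) simp
    from xy(2) obtain i j where ij: "i < 20" "j \<in> set (nbrs ! i)" "x = vtx i" "y = vtx j"
      by (rule adj_cases)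
    have j: "j < 20" using ij(1,2) by (rule nbrs_less)
    have ji: "i \<in> set (nbrs ! j)"
      using adj_sym[OF xy(2)] ij j by (simp add: adj_vtx)
    have "nx j i < 20" using nbrs_less[OF j nx_facts(1)[OF j ji]] .
    then show "C (face_step p) = C p"
      using ok[OF ij(1,2)] ij j xy(1) by (simp add: face_step_def nxt_vtx[OF j ji] C walk_def)
  next
    fix x y assume "adj x y"
    then obtain i j where ij: "i < 20" "j \<in> set (nbrs ! i)" "x = vtx i" "y = vtx j"
      by (rule adj_cases)
    have j: "j < 20" using ij(1,2) by (rule nbrs_less)
    have "C (- x, - y) = C (vtx (19 - i), vtx (19 - j))"
      using ij j by (simp add: vtx_minus)
    then show "C (- x, - y) = C (y, x)"
      using ok[OF ij(1,2)] ij j by (simp add: C)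
    have t: "osgn E x = combine t (vertex_weights ! i)" "osgn E y = combine t (vertex_weights ! j)"
      using osgn_vtx[OF sum] ij j by (simp_all add: t_def[abs_def])
    have dvd: "3 dvd vertex_weights ! i ! k - vertex_weights ! j ! k
        + face_weights (i, j) ! k - face_weights (j, i) ! k" if "k \<in> {0, 1, 2, 3}" for k
      using ok[OF ij(1,2)] that by auto
    have Cxy: "C (x, y) = combine t (face_weights (i, j))" "C (y, x) = combine t (face_weights (j, i))"
      using ij j by (simp_all add: C)
    define w where "w k = vertex_weights ! i ! k - vertex_weights ! j ! k
        + face_weights (i, j) ! k - face_weights (j, i) ! k" for k
    have "osgn E x - osgn E y + C (x, y) - C (y, x) = w 0 * t 0 + w 1 * t 1 + w 2 * t 2 + w 3 * t 3"
      unfolding t Cxy combine_def w_def by (simp add: algebra_simps)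
    also have "3 dvd \<dots>"
      using dvd by (intro dvd_add dvd_mult2) (simp_all add: w_def)
    finally show "3 dvd osgn E x - osgn E y + C (x, y) - C (y, x)" .
  qed
qed

text \<open>Adding a boundary makes \<open>u_edge E\<close> divisible by 3 on every cell: on edge
  cells by the congruence for \<open>C\<close>, on truncation cells because equal values on
  antipodal faces cancel.\<close>

lemma exists_third_of_u_edge:
  assumes E: "E \<subseteq> dodeca_vertices"
    and sum: "\<And>x. x \<in> dodeca_vertices \<Longrightarrow> (\<Sum>y\<in>{y. adj x y}. osgn E y) = 0"
  obtains U where "Z1 U" "homologous (\<lambda>d. 3 * U d) (u_edge E)"
proof -
  obtain C where C: "\<And>p. p \<in> oedges \<Longrightarrow> C (face_step p) = C p"
    "\<And>x y. adj x y \<Longrightarrow> C (- x, - y) = C (y, x)"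
    "\<And>x y. adj x y \<Longrightarrow> 3 dvd osgn E x - osgn E y + C (x, y) - C (y, x)"
    using exists_face_potential[OF sum] by blast
  \<comment> \<open>each face is counted from its five edges, and \<open>- 5 * C\<close> is \<open>C\<close> modulo \<open>3\<close>\<close>
  define F where "F d = (\<Sum>p\<in>oedges. - C p * face_chain (fst p) (snd p) d)" for d
  define W where "W d = u_edge E d + F d" for d
  define C' where "C' p = - 5 * C p" for p
  have C': "C' (face_step p) = C' p" if "p \<in> oedges" for p
    using C(1)[OF that] by (simp add: C'_def)
  have F: "F d = (\<Sum>p\<in>oedges. C' p * face_cell p d)" for d
    unfolding F_def face_sum_eq
    by (intro sum.cong refl, subst face_coeff_invariant) (simp_all add: C C'_def)
  have "Z1 F"
    unfolding F[abs_def] by (rule Z1_face_sum) (rule C')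
  then have W: "Z1 W"
    unfolding W_def[abs_def] by (intro Z1_add Z1_u_edge)
  have W_Ed: "3 dvd W (Ed x y)" if "adj x y" for x y
  proof -
    have eq: "W (Ed x y) = (osgn E x - osgn E y + C (x, y) - C (y, x)) + 3 * (2 * C (y, x) - 2 * C (x, y))"
      using face_sum_values(1)[where C=C', OF C' that] u_edge_Ed[OF E that] that
      by (simp add: W_def F C'_def)
    show ?thesis
      unfolding eq by (intro dvd_add C(3)[OF that] dvd_triv_left)
  qed
  have W_Tr: "W (Tr x y (nxt x y)) = 0" if "adj x y" for x y
    using face_sum_values(2)[where C=C', OF C' that] C(2)[OF that] by (simp add: W_def F C'_def)
  have dvd: "3 dvd W d" for d
  proof (cases "d \<in> darts")
    case True
    then show ?thesis
    proof (cases d)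
      case (Ed x y)
      with True W_Ed show ?thesis by simp
    next
      case (Tr x y z)
      with True nbr_cases consider "adj x y" "z = nxt x y" | "adj x y" "z = prv x y" by auto
      then show ?thesis
      proof cases
        case 1
        with W_Tr Tr show ?thesis by simp
      next
        case 2
        have "W d = 0"
          using 2 W_Tr[of x "prv x y"]
            chain1_Tr_prv[OF Z1_chain1[OF W], of x y]
          by (simp add: \<open>d = Tr x y z\<close> adj_prv)
        then show ?thesis by simp
      qed
    qed
  next
    case False
    with W show ?thesis by (simp add: Z1_def chain1_def)
  qed
  define U where "U d = W d div 3" for d
  have U: "(\<lambda>d. 3 * U d) = W"
    using dvd by (simp add: U_def fun_eq_iff)
  show thesis
  proof
    show "Z1 U"
      by (rule Z1_cancel[of 3]) (simp_all add: U W)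
    show "homologous (\<lambda>d. 3 * U d) (u_edge E)"
      unfolding U homologous_def using W Z1_u_edge
      by (auto simp: W_def F_def intro!: exI[of _ "\<lambda>p. - C p"])
  qed
qed

section \<open>The action of the two monodromies\<close>

theorem theorem4p1:
  fixes e E :: "(real^3) set"
  assumes "e \<in> cubes" and "tetra_of e E"
  shows "homologous (rho_trc (u_trc E)) (u_trc E)
    \<and> (\<exists>U. Z1 U \<and> homologous (\<lambda>d. 3 * U d) (u_edge E))
    \<and> (\<forall>U. Z1 U \<and> homologous (\<lambda>d. 3 * U d) (u_edge E) \<longrightarrow>
          homologous (rho_trc U) (\<lambda>d. U d + u_trc E d)
        \<and> homologous (rho_edge U) U
        \<and> homologous (rho_edge (u_trc E)) (\<lambda>d. u_trc E d - 3 * U d))"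
proof (intro conjI allI impI)
  \<comment> \<open>A \<int>\<I>-map out of V_o is determined by its value at the class of
    \<open>e\<close>, so equalities of maps are tested there, as homologies. Any \<open>U\<close>
    whose triple is homologous to \<open>u_edge E\<close> represents the value of U_edge.\<close>
  have E: "E \<subseteq> dodeca_vertices"
    using assms by (auto simp: tetra_of_def cubes_def inscribed_cube_def)
  note sum = tetra_nbrs_sum[OF assms]
  have trc: "Z1 (u_trc E)" using E by (rule Z1_u_trc)
  \<comment> \<open>\<open>u_trc E\<close> vanishes on edge cells, so \<open>rho_trc_eq\<close>
    applies with the empty set and the correction is an empty sum.\<close>
  have "rho_trc (u_trc E) = (\<lambda>d. u_trc E d + u_trc {} d)"
    by (rule rho_trc_eq[OF trc]) (simp_all add: osgn_def)
  then show "homologous (rho_trc (u_trc E)) (u_trc E)"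
    using homologous_refl[OF trc] by (simp add: u_trc_def)
  show "\<exists>U. Z1 U \<and> homologous (\<lambda>d. 3 * U d) (u_edge E)"
    using exists_third_of_u_edge[OF E sum] by metis
  fix U assume "Z1 U \<and> homologous (\<lambda>d. 3 * U d) (u_edge E)"
  then have U: "Z1 U" and hom: "homologous (\<lambda>d. 3 * U d) (u_edge E)" by auto
  have U1: "chain1 U" using U by (rule Z1_chain1)
  obtain C where C: "\<And>p. p \<in> oedges \<Longrightarrow> C (face_step p) = C p"
    and Ed: "\<And>x y. adj x y \<Longrightarrow> 3 * U (Ed x y) = u_edge E (Ed x y) + C (x, y) - C (y, x)"
    and Tr: "\<And>x y. adj x y \<Longrightarrow> 3 * U (Tr x y (nxt x y))
        = u_edge E (Tr x y (nxt x y)) + C (y, x) - C (- x, - y)"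
    using homologous_coeff[OF hom] by blast
  have "rho_trc U = (\<lambda>d. U d + u_trc E d)"
  proof (rule rho_trc_eq[OF U E])
    fix x assume x: "x \<in> dodeca_vertices"
    obtain y where xy: "adj x y" using x by (rule vertex_has_nbr)
    \<comment> \<open>Summed over the neighbours, \<sigma> y drops out, \<sigma> x occurs three
      times, and the two \<open>C\<close> terms agree up to a rotation around
      \<open>x\<close>.\<close>
    have "3 * (\<Sum>y\<in>{y. adj x y}. U (Ed x y))
        = (\<Sum>y\<in>{y. adj x y}. osgn E x - osgn E y + C (x, y) - C (x, nxt x y))"
      unfolding sum_distrib_left
      by (intro sum.cong refl) (use Ed face_sum_nxt(1)[where C=C, OF C] u_edge_Ed[OF E] in auto)
    also have "\<dots> = (\<Sum>y\<in>{y. adj x y}. osgn E x)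
        + (\<Sum>y\<in>{y. adj x y}. C (x, y)) - (\<Sum>y\<in>{y. adj x y}. C (x, nxt x y))"
      using sum[OF x] by (simp only: sum_subtractf sum.distrib)
    also have "(\<Sum>y\<in>{y. adj x y}. C (x, nxt x y)) = (\<Sum>y\<in>{y. adj x y}. C (x, y))"
      by (rule sum.reindex_bij_witness[of _ "prv x" "nxt x"])
        (auto simp: nxt_facts(1,6) adj_prv prv_nxt)
    also have "(\<Sum>y\<in>{y. adj x y}. osgn E x) = 3 * osgn E x"
      using sum_nbrs[OF xy, of "\<lambda>_. osgn E x"] by simp
    finally show "(\<Sum>y\<in>{y. adj x y}. U (Ed x y)) = osgn E x" by simp
  qed
  then show "homologous (rho_trc U) (\<lambda>d. U d + u_trc E d)"
    using homologous_refl[OF Z1_add[OF U trc]] by simp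
  \<comment> \<open>\<open>u_edge E\<close> vanishes on truncation cells, so both truncation values
    below come from \<open>C\<close> alone, and they are opposite: \<open>U\<close> has intersection
    number 0 with every edge loop.\<close>
  have "rho_edge U = (\<lambda>d. U d - u_edge {} d)"
  proof (rule rho_edge_eq[OF U])
    fix x y :: "real^3" assume xy: "adj x y"
    have "3 * U (Tr x y (prv x y)) = C (- y, - x) - C (x, y)"
      using Tr[OF adj_prv[OF xy]] face_sum_nxt(2,3)[where C=C, OF C xy] chain1_Tr_prv[OF U1 xy] by simp
    moreover have "3 * U (Tr y x (nxt y x)) = C (x, y) - C (- y, - x)"
      using Tr[OF adj_sym[OF xy]] by simp
    ultimately show "U (Tr x y (prv x y)) + U (Tr y x (nxt y x)) = osgn {} y - osgn {} x"
      by (simp add: osgn_def)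
  qed simp
  then show "homologous (rho_edge U) U"
    using homologous_refl[OF U] by (simp add: u_edge_def)
  have rho: "rho_edge (u_trc E) = (\<lambda>d. u_trc E d - u_edge E d)"
  proof (rule rho_edge_eq[OF trc E])
    fix x y assume xy: "adj x y"
    show "u_trc E (Tr x y (prv x y)) + u_trc E (Tr y x (nxt y x)) = osgn E y - osgn E x"
      using u_trc_Tr[OF E adj_prv[OF xy]] u_trc_Tr[OF E adj_sym[OF xy]]
        chain1_Tr_prv[OF Z1_chain1[OF trc] xy] by simp
  qed
  \<comment> \<open>The two sides of the last claim differ by \<open>3 * U d - u_edge E d\<close>,
    so the face coefficients \<open>c\<close> of the given homology serve again.\<close>
  obtain c where c: "\<And>d. 3 * U d - u_edge E d = (\<Sum>p\<in>oedges. c p * face_chain (fst p) (snd p) d)"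
    using hom unfolding homologous_def by blast
  have "Z1 (\<lambda>d. u_trc E d + (-1) * u_edge E d)" "Z1 (\<lambda>d. u_trc E d + (-3) * U d)"
    by (intro Z1_add Z1_mult trc U Z1_u_edge)+
  then show "homologous (rho_edge (u_trc E)) (\<lambda>d. u_trc E d - 3 * U d)"
    unfolding homologous_def rho using c by (auto intro!: exI[of _ c])
qed

end
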